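(* Fix $\rho\in[-1,1]$ and $\beta=(\sigma,\tau)\in\mathbb{R}^2$. If $\sigma^2=1/2$ and $\tau\neq0$, then, as $N\to\infty$, $$\frac{\mathcal{Z}_N(\beta)-N^{1+\frac12(\frac12-\tau^2)+i\sigma\tau\rho}}{N}\;\longrightarrow\;N_{\mathbb{C}}(0,1/2)\qquad\text{in distribution.}$$
   Context: Let $(X_1,Y_1),(X_2,Y_2),\ldots$ be i.i.d. zero-mean bivariate real Gaussian vectors with $\mathrm{Var}\,X_k=\mathrm{Var}\,Y_k=1$ and $\mathrm{Corr}(X_k,Y_k)=\rho$. For $N\in\mathbb{N}$ put $n=\log N$ (natural logarithm) and $\mathcal{Z}_N(\beta)=\sum_{k=1}^N e^{\sqrt n(\sigma X_k+i\tau Y_k)}$. For $z\in\mathbb{C}$, $N^z=e^{nz}$. $N_{\mathbb{C}}(0,s^2)$ denotes the complex Gaussian distribution with density $z\mapsto\frac1{\pi s^2}e^{-|z/s|^2}$ with respect to Lebesgue measure on $\mathbb{C}$. *)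

theory Defs
  imports "HOL-Probability.Probability"
begin

(* Univariate Gaussian law; point masses count as (degenerate) Gaussians. *)
definition gaussian_law :: "real measure \<Rightarrow> bool" where
  "gaussian_law D \<longleftrightarrow>
     (\<exists>m. D = return borel m) \<or>
     (\<exists>m s. s > 0 \<and> D = density lborel (\<lambda>x. ennreal (normal_density m s x)))"

(* A bivariate Gaussian vector is a pair all of whose linear combinations are Gaussian.  The
   correlation may be 1 or -1, so the joint law need not have a density on the plane. *)
definition bivariate_gaussian :: "'a measure \<Rightarrow> ('a \<Rightarrow> real) \<Rightarrow> ('a \<Rightarrow> real) \<Rightarrow> bool" where
  "bivariate_gaussian M X Y \<longleftrightarrow>
     X \<in> borel_measurable M \<and> Y \<in> borel_measurable M \<and>
     (\<forall>a b. gaussian_law (distr M borel (\<lambda>\<omega>. a * X \<omega> + b * Y \<omega>)))"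

definition covariance :: "'a measure \<Rightarrow> ('a \<Rightarrow> real) \<Rightarrow> ('a \<Rightarrow> real) \<Rightarrow> real" where
  "covariance M X Y =
     (\<integral>\<omega>. (X \<omega> - integral\<^sup>L M X) * (Y \<omega> - integral\<^sup>L M Y) \<partial>M)"

definition correlation :: "'a measure \<Rightarrow> ('a \<Rightarrow> real) \<Rightarrow> ('a \<Rightarrow> real) \<Rightarrow> real" where
  "correlation M X Y =
     covariance M X Y / (sqrt (prob_space.variance M X) * sqrt (prob_space.variance M Y))"

(* The vectors are indexed from 1; entries X 0 and Y 0 are unconstrained and never used. *)
definition iid_gaussian_pairs ::
    "'a measure \<Rightarrow> real \<Rightarrow> (nat \<Rightarrow> 'a \<Rightarrow> real) \<Rightarrow> (nat \<Rightarrow> 'a \<Rightarrow> real) \<Rightarrow> bool" where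
  "iid_gaussian_pairs M \<rho> X Y \<longleftrightarrow>
     prob_space M \<and>
     prob_space.indep_vars M (\<lambda>_. borel :: (real \<times> real) measure)
       (\<lambda>k \<omega>. (X k \<omega>, Y k \<omega>)) {1..} \<and>
     (\<forall>j\<ge>1. \<forall>k\<ge>1. distr M (borel :: (real \<times> real) measure) (\<lambda>\<omega>. (X j \<omega>, Y j \<omega>)) =
                      distr M borel (\<lambda>\<omega>. (X k \<omega>, Y k \<omega>))) \<and>
     (\<forall>k\<ge>1. bivariate_gaussian M (X k) (Y k) \<and>
            integral\<^sup>L M (X k) = 0 \<and> integral\<^sup>L M (Y k) = 0 \<and>
            prob_space.variance M (X k) = 1 \<and> prob_space.variance M (Y k) = 1 \<and>
            correlation M (X k) (Y k) = \<rho>)"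

definition partition_function ::
    "(nat \<Rightarrow> 'a \<Rightarrow> real) \<Rightarrow> (nat \<Rightarrow> 'a \<Rightarrow> real) \<Rightarrow> real \<times> real \<Rightarrow> nat \<Rightarrow> 'a \<Rightarrow> complex" where
  "partition_function X Y \<beta> N \<omega> =
     (\<Sum>k = 1..N. exp (complex_of_real (sqrt (ln (real N))) *
        (complex_of_real (fst \<beta> * X k \<omega>) + \<i> * complex_of_real (snd \<beta> * Y k \<omega>))))"

definition nat_cpow :: "nat \<Rightarrow> complex \<Rightarrow> complex" where
  "nat_cpow N z = exp (complex_of_real (ln (real N)) * z)"

(* The parameter v is the second absolute moment s^2 of N_C(0, s^2), not s. *)
definition complex_normal :: "real \<Rightarrow> complex measure" where
  "complex_normal v =
     density lborel (\<lambda>z. ennreal (1 / (pi * v) * exp (- (cmod (z / complex_of_real (sqrt v)))\<^sup>2)))"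

(* The library's weak_conv_m is confined to measures on the real line. *)
definition converges_in_distribution ::
    "'a measure \<Rightarrow> (nat \<Rightarrow> 'a \<Rightarrow> 'b::topological_space) \<Rightarrow> 'b measure \<Rightarrow> bool" where
  "converges_in_distribution M Z D \<longleftrightarrow>
     (\<forall>f :: 'b \<Rightarrow> real. continuous_on UNIV f \<and> bounded (range f) \<longrightarrow>
        (\<lambda>N. \<integral>x. f x \<partial>(distr M borel (Z N))) \<longlonglongrightarrow> (\<integral>x. f x \<partial>D))"

end

theory Submission
  imports Defs
begin

text \<open>
  Write \<open>n = ln N\<close> and let \<open>U\<close> be one summand of the partition function divided by \<open>N\<close>. The
  normalised variable of the theorem is the sum of \<open>N\<close> independent copies of \<open>U\<close> minus its mean.
  So its characteristic function at \<open>c\<close> is an \<open>N\<close>-th power, and everything rests on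
  the asymptotics of \<open>N * E H(U)\<close>, where \<open>H(u) = cis (c \<bullet> u) - 1 - \<i> * (c \<bullet> u)\<close>.

  The summands do not satisfy the Lindeberg condition: the second moment of \<open>U\<close> is \<open>1/N\<close>, but it
  is carried half by the event \<open>cmod U < 1\<close> and half by the very rare event \<open>cmod U > 1\<close>. To see
  both at once, tilt the law of \<open>X\<close> by the density proportional to \<open>(cmod U)\<^sup>2\<close>. Tilting is a shift
  of \<open>X\<close>, and because \<open>\<sigma>\<^sup>2 = 1/2\<close> it yields exactly \<open>N * E H(U) = E (H(V) / (cmod V)\<^sup>2)\<close>, where
  \<open>cmod V = exp (sqrt n * \<sigma> * x)\<close> for a standard normal \<open>x\<close> (\<open>remainder_tilt\<close>). The function
  \<open>H(u) / (cmod u)\<^sup>2\<close> is bounded, tends to 0 at infinity, and near 0 equals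
  \<open>- (c \<bullet> u)\<^sup>2 / (2 * (cmod u)\<^sup>2)\<close> up to a small error. By dominated convergence only the half-line
  \<open>\<sigma> * x < 0\<close> contributes, which is where the variance 1/2 of the limit comes from.

  The quadratic term depends on the phase of \<open>V\<close> through \<open>cis\<close> of twice the phase. As
  \<open>\<tau> \<noteq> 0\<close>, the phase winds faster and faster and this part averages out
  (\<open>oscillation_vanishes\<close>): if \<open>\<bar>\<rho>\<bar> < 1\<close> through the component of \<open>Y\<close> independent of \<open>X\<close>, and
  if \<open>\<bar>\<rho>\<bar> = 1\<close> because the Fourier transform of a half Gaussian decays. What remains is
  \<open>- (cmod c)\<^sup>2 / 8\<close> (\<open>remainder_integral_tendsto\<close>), the exponent of the complex normal law with second
  moment 1/2. The mean of \<open>U\<close> is so small that centring does not change the limit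
  (\<open>centred_char_asymptotics\<close>).

  Two facts about laws in the plane complete the argument. Pointwise convergence of characteristic
  functions implies convergence of integrals of bounded continuous functions
  (\<open>planar_levy_continuity\<close>); this is reduced to the Levy theorem on the line for tightness, and
  to the Stone-Weierstrass theorem on a torus. As a consequence characteristic functions determine laws
  (\<open>planar_char_unique\<close>), which identifies the joint law of \<open>(X, Y)\<close> with that of
  \<open>(G, \<rho> * G + sqrt (1 - \<rho>\<^sup>2) * G')\<close> for independent standard normals \<open>G\<close> and \<open>G'\<close>
  (\<open>bivariate_gaussian_law\<close>).
\<close>

section \<open>Uniform approximation by trigonometric polynomials in the plane\<close>

inductive trig_poly :: "(complex \<Rightarrow> complex) \<Rightarrow> bool" where
  wave: "trig_poly (\<lambda>z. cis (c \<bullet> z))"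
| scale: "trig_poly f \<Longrightarrow> trig_poly (\<lambda>z. a * f z)"
| add: "trig_poly f \<Longrightarrow> trig_poly g \<Longrightarrow> trig_poly (\<lambda>z. f z + g z)"

lemma trig_poly_wave_mult:
  "trig_poly g \<Longrightarrow> trig_poly (\<lambda>z. cis (c \<bullet> z) * g z)"
proof (induction rule: trig_poly.induct)
  case (wave d)
  show ?case
    using trig_poly.wave[of "c + d"] by (simp add: cis_mult inner_add_left)
next
  case (scale f a)
  from trig_poly.scale[OF scale.IH, of a] show ?case by (simp add: mult_ac)
next
  case (add f g)
  from trig_poly.add[OF add.IH] show ?case by (simp add: distrib_left)
qed

lemma trig_poly_mult:
  "trig_poly f \<Longrightarrow> trig_poly g \<Longrightarrow> trig_poly (\<lambda>z. f z * g z)"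
proof (induction rule: trig_poly.induct)
  case (wave c)
  then show ?case by (rule trig_poly_wave_mult)
next
  case (scale f a)
  from trig_poly.scale[OF scale.IH[OF scale.prems], of a] show ?case by (simp add: mult_ac)
next
  case (add f1 f2)
  from trig_poly.add[OF add.IH(1)[OF add.prems] add.IH(2)[OF add.prems]]
  show ?case by (simp add: distrib_right)
qed

lemma trig_poly_const: "trig_poly (\<lambda>z. a)"
  using trig_poly.scale[OF trig_poly.wave[of 0], of a] by simp

lemma trig_poly_cos: "trig_poly (\<lambda>z. complex_of_real (cos (c \<bullet> z)))"
proof -
  have "trig_poly (\<lambda>z. (1/2) * (cis (c \<bullet> z) + cis ((-c) \<bullet> z)))"
    by (intro trig_poly.intros)
  also have "(\<lambda>z. (1/2) * (cis (c \<bullet> z) + cis ((-c) \<bullet> z))) = (\<lambda>z. complex_of_real (cos (c \<bullet> z)))"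
    by (auto simp: complex_eq_iff)
  finally show ?thesis .
qed

lemma trig_poly_sin: "trig_poly (\<lambda>z. complex_of_real (sin (c \<bullet> z)))"
proof -
  have "trig_poly (\<lambda>z. (- \<i>/2) * (cis (c \<bullet> z) + (-1) * cis ((-c) \<bullet> z)))"
    by (intro trig_poly.intros)
  also have "(\<lambda>z. (- \<i>/2) * (cis (c \<bullet> z) + (-1) * cis ((-c) \<bullet> z))) = (\<lambda>z. complex_of_real (sin (c \<bullet> z)))"
    by (auto simp: complex_eq_iff)
  finally show ?thesis .
qed

lemma cis_eq_on_period:
  assumes K: "0 < K" and x: "\<bar>x\<bar> \<le> K" and y: "\<bar>y\<bar> \<le> K"
    and eq: "cis (pi * x / K) = cis (pi * y / K)"
  shows "x = y \<or> \<bar>x\<bar> = K \<and> \<bar>y\<bar> = K"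
proof -
  have "\<exists>n::int. pi * x / K = pi * y / K + 2 * pi * n"
    using eq sin_cos_eq_iff[of "pi * x / K" "pi * y / K"] by (simp add: complex_eq_iff)
  then obtain n :: int where "pi * x / K = pi * y / K + 2 * pi * n" by blast
  then have "pi * (x / K) = pi * (y / K + 2 * n)" by (simp add: algebra_simps)
  then have "x / K = y / K + 2 * n"
    using pi_neq_zero by (simp only: mult_cancel_left) simp
  then have n: "x = y + 2 * n * K" using K by (simp add: field_simps)
  have "\<bar>2 * real_of_int n * K\<bar> \<le> 2 * K" using n x y by linarith
  then have "\<bar>real_of_int n\<bar> \<le> 1" using K by (simp add: abs_mult)
  then have "n = 0 \<or> n = 1 \<or> n = -1" by linarith
  then show ?thesis
    using n x y K by auto
qed

text \<open>Since \<open>h\<close> vanishes on the boundary of the square of half-width \<open>K\<close>, it takes equal values at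
points that are identified when opposite sides are glued, and so descends to a continuous function
on a torus. There the Stone-Weierstrass theorem applies: the coordinates of the torus separate its
points, and they are trigonometric functions of \<open>z\<close>. The approximation is periodic, which
gives a bound on the whole plane and not only on the square; this is what makes it usable
together with tightness.\<close>
lemma periodic_trig_approximation:
  fixes h :: "complex \<Rightarrow> real"
  assumes K: "0 < K" and e: "0 < e" and cont: "continuous_on UNIV h"
    and bound: "\<And>z. \<bar>h z\<bar> \<le> C"
    and vanish: "\<And>z. \<bar>Re z\<bar> = K \<or> \<bar>Im z\<bar> = K \<Longrightarrow> h z = 0"
  obtains g where "trig_poly (\<lambda>z. complex_of_real (g z))"
    "\<And>z. \<bar>Re z\<bar> \<le> K \<Longrightarrow> \<bar>Im z\<bar> \<le> K \<Longrightarrow> \<bar>h z - g z\<bar> < e" "\<And>z. \<bar>g z\<bar> \<le> C + e"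
proof -
  define q where "q z = (cis (pi * Re z / K), cis (pi * Im z / K))" for z
  define B where "B = cbox (Complex (-K) (-K)) (Complex K K)"
  define T where "T = q ` B"
  have B_iff: "z \<in> B \<longleftrightarrow> \<bar>Re z\<bar> \<le> K \<and> \<bar>Im z\<bar> \<le> K" for z
    by (auto simp: B_def in_cbox_complex_iff)
  have cont_q: "continuous_on A q" for A
    unfolding q_def cis_conv_exp by (intro continuous_intros) (use K in auto)
  have compact_T: "compact T"
    unfolding T_def B_def by (intro compact_continuous_image cont_q compact_cbox)
  have quot: "quotient_map (top_of_set B) (top_of_set T) q"
  proof (rule continuous_imp_quotient_map)
    show "continuous_map (top_of_set B) (top_of_set T) q"
      using cont_q by (auto simp: T_def continuous_map_in_subtopology)
    show "compact_space (top_of_set B)"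
      by (simp add: B_def compact_space_subtopology)
    show "Hausdorff_space (top_of_set T)"
      by (simp add: Hausdorff_space_subtopology)
  qed (simp add: T_def)
  obtain H where H: "continuous_map (top_of_set T) euclideanreal H" "\<And>z. z \<in> B \<Longrightarrow> H (q z) = h z"
  proof (rule quotient_map_lift_exists[OF quot])
    show "continuous_map (top_of_set B) euclideanreal h"
      using cont continuous_on_subset by auto
    show "h x = h y" if "x \<in> topspace (top_of_set B)" "y \<in> topspace (top_of_set B)" "q x = q y" for x y
    proof -
      have "Re x = Re y \<or> \<bar>Re x\<bar> = K \<and> \<bar>Re y\<bar> = K"
        using that K by (intro cis_eq_on_period) (auto simp: B_iff q_def)
      moreover have "Im x = Im y \<or> \<bar>Im x\<bar> = K \<and> \<bar>Im y\<bar> = K"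
        using that K by (intro cis_eq_on_period) (auto simp: B_iff q_def)
      ultimately show ?thesis using vanish complex_eqI by metis
    qed
  qed auto
  let ?P = "\<lambda>F. continuous_on T F \<and> trig_poly (\<lambda>z. complex_of_real (F (q z)))"
  have q1: "cis (pi * Re z / K) = cis (complex_of_real (pi/K) \<bullet> z)"
    and q2: "cis (pi * Im z / K) = cis ((\<i> * complex_of_real (pi/K)) \<bullet> z)" for z
    by (simp_all add: inner_complex_def)
  have "\<exists>G. ?P G \<and> (\<forall>x\<in>T. \<bar>H x - G x\<bar> < e)"
  proof (rule Stone_Weierstrass_HOL[OF compact_T])
    show "?P (\<lambda>x. c)" for c by (simp add: trig_poly_const)
    show "continuous_on T f" if "?P f" for f using that by blast
    show "?P (\<lambda>x. f x + g x)" if "?P f \<and> ?P g" for f g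
      using that by (auto intro: continuous_on_add trig_poly.add)
    show "?P (\<lambda>x. f x * g x)" if "?P f \<and> ?P g" for f g
      using that by (auto intro: continuous_on_mult trig_poly_mult)
    show "continuous_on T H" using H(1) by simp
    show "\<exists>f. ?P f \<and> f x \<noteq> f y" if "x \<in> T \<and> y \<in> T \<and> x \<noteq> y" for x y :: "complex \<times> complex"
    proof -
      have "?P (\<lambda>p. Re (fst p))" "?P (\<lambda>p. Im (fst p))" "?P (\<lambda>p. Re (snd p))" "?P (\<lambda>p. Im (snd p))"
        unfolding q_def q1 q2 by (auto intro!: continuous_intros trig_poly_cos trig_poly_sin)
      moreover have "Re (fst x) \<noteq> Re (fst y) \<or> Im (fst x) \<noteq> Im (fst y) \<or> Re (snd x) \<noteq> Re (snd y)
          \<or> Im (snd x) \<noteq> Im (snd y)"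
        using that by (auto simp: complex_eq_iff prod_eq_iff)
      ultimately show ?thesis by blast
    qed
  qed (use e in auto)
  then obtain G where G: "?P G" "\<And>x. x \<in> T \<Longrightarrow> \<bar>H x - G x\<bar> < e" by blast
  show ?thesis
  proof (rule that[of "\<lambda>z. G (q z)"])
    show "trig_poly (\<lambda>z. complex_of_real (G (q z)))" using G by blast
    show close: "\<bar>h z - G (q z)\<bar> < e" if "\<bar>Re z\<bar> \<le> K" "\<bar>Im z\<bar> \<le> K" for z
      using G(2)[of "q z"] H(2)[of z] that by (auto simp: T_def B_iff)
    show "\<bar>G (q z)\<bar> \<le> C + e" for z
    proof -
      \<comment> \<open>The representative of \<open>u\<close> modulo \<open>2 * K\<close> in the fundamental interval.\<close>
      define p where "p u = K * Arg (cis (pi * u / K)) / pi" for u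
      have p: "\<bar>p u\<bar> \<le> K" "cis (pi * p u / K) = cis (pi * u / K)" for u
      proof -
        have "\<bar>Arg (cis (pi * u / K))\<bar> \<le> pi" using Arg_bounded[of "cis (pi * u / K)"] by auto
        then show "\<bar>p u\<bar> \<le> K" using K by (simp add: p_def abs_mult field_simps)
        show "cis (pi * p u / K) = cis (pi * u / K)"
          using K by (simp add: p_def cis_Arg sgn_div_norm)
      qed
      have "q (Complex (p (Re z)) (p (Im z))) = q z" by (simp add: q_def p)
      then have "\<bar>h (Complex (p (Re z)) (p (Im z))) - G (q z)\<bar> < e"
        using close[of "Complex (p (Re z)) (p (Im z))"] by (simp add: p)
      then show ?thesis using bound[of "Complex (p (Re z)) (p (Im z))"] by linarith
    qed
  qed
qed

section \<open>Levy continuity and uniqueness for laws on the complex plane\<close>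

definition planar_char :: "complex measure \<Rightarrow> complex \<Rightarrow> complex" where
  "planar_char \<mu> c = (\<integral>z. cis (c \<bullet> z) \<partial>\<mu>)"

lemma planar_char_distr:
  assumes "f \<in> borel_measurable M"
  shows "planar_char (distr M borel f) c = (\<integral>x. cis (c \<bullet> f x) \<partial>M)"
  unfolding planar_char_def using assms by (intro integral_distr) (auto simp: cis_conv_exp)

lemma measurable_cis [measurable]: "cis \<in> borel_measurable borel"
  unfolding cis_conv_exp by measurable

lemma measurable_inner_const [measurable]: "(\<bullet>) c \<in> borel_measurable (borel :: complex measure)"
  by (intro borel_measurable_continuous_onI continuous_intros)

lemma char_distr_inner:
  assumes [measurable_cong]: "sets \<mu> = sets borel"
  shows "char (distr \<mu> borel (\<lambda>z. c \<bullet> z)) t = planar_char \<mu> (t *\<^sub>R c)"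
  unfolding char_def planar_char_def
  by (subst integral_distr) (auto simp: cis_conv_exp)

lemma trig_poly_bounded_measurable:
  assumes "trig_poly g"
  shows "g \<in> borel_measurable borel \<and> (\<exists>B. \<forall>z. cmod (g z) \<le> B)"
  using assms
proof (induction rule: trig_poly.induct)
  case (wave c)
  show ?case by (auto intro: exI[of _ 1])
next
  case (scale f a)
  then obtain B where "\<And>z. cmod (f z) \<le> B" by blast
  then have "\<forall>z. cmod (a * f z) \<le> cmod a * B"
    by (auto simp: norm_mult intro: mult_left_mono)
  with scale show ?case by (auto intro: exI)
next
  case (add f g)
  then obtain B C where "\<And>z. cmod (f z) \<le> B" "\<And>z. cmod (g z) \<le> C" by blast
  then have "\<forall>z. cmod (f z + g z) \<le> B + C"
    by (meson add_mono norm_triangle_le)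
  with add show ?case by (auto intro: exI)
qed

lemma integrable_trig_poly:
  assumes "prob_space \<mu>" and [measurable_cong]: "sets \<mu> = sets borel" and g: "trig_poly g"
  shows "integrable \<mu> g"
proof -
  interpret prob_space \<mu> by fact
  obtain B where "\<And>z. cmod (g z) \<le> B" and [measurable]: "g \<in> borel_measurable borel"
    using trig_poly_bounded_measurable[OF g] by blast
  then show ?thesis by (intro integrable_const_bound[where B=B]) auto
qed

lemma trig_poly_integral_converges:
  assumes prob: "\<And>n. prob_space (\<mu> n)" "prob_space \<nu>"
    and sets: "\<And>n. sets (\<mu> n) = sets borel" "sets \<nu> = sets borel"
    and conv: "\<And>c. (\<lambda>n. planar_char (\<mu> n) c) \<longlonglongrightarrow> planar_char \<nu> c"
    and g: "trig_poly g"
  shows "(\<lambda>n. \<integral>z. g z \<partial>\<mu> n) \<longlonglongrightarrow> (\<integral>z. g z \<partial>\<nu>)"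
  using g
proof (induction rule: trig_poly.induct)
  case (wave c)
  then show ?case using conv by (simp add: planar_char_def)
next
  case (scale f a)
  then show ?case by (simp add: tendsto_mult_left)
next
  case (add f g)
  then show ?case
    using prob sets by (simp add: Bochner_Integration.integral_add integrable_trig_poly tendsto_add)
qed

text \<open>A continuous majorant of the indicator of \<open>R + 1 \<le> \<bar>x\<bar>\<close> that vanishes for \<open>\<bar>x\<bar> \<le> R\<close>.\<close>
definition tail_ramp :: "real \<Rightarrow> real \<Rightarrow> real" where
  "tail_ramp R x = min 1 (max 0 (\<bar>x\<bar> - R))"

lemma tail_ramp_bounds: "0 \<le> tail_ramp R x" "tail_ramp R x \<le> 1" "\<bar>tail_ramp R x\<bar> \<le> 1"
  by (auto simp: tail_ramp_def)

lemma continuous_tail_ramp [continuous_intros]: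
  "continuous_on A f \<Longrightarrow> continuous_on A (\<lambda>x. tail_ramp R (f x))"
  unfolding tail_ramp_def by (intro continuous_intros)

lemma measurable_tail_ramp [measurable]: "tail_ramp R \<in> borel_measurable borel"
  by (intro borel_measurable_continuous_onI continuous_intros)

text \<open>Each marginal converges weakly by the one-dimensional Levy theorem, and a continuous bounded
cut-off can be integrated in the limit. This is the source of tightness.\<close>
lemma marginal_tail_converges:
  assumes prob: "\<And>n. prob_space (\<mu> n)" "prob_space \<nu>"
    and sets [measurable_cong]: "\<And>n. sets (\<mu> n) = sets borel" "sets \<nu> = sets borel"
    and conv: "\<And>c. (\<lambda>n. planar_char (\<mu> n) c) \<longlonglongrightarrow> planar_char \<nu> c"
  shows "(\<lambda>n. \<integral>z. tail_ramp R (c \<bullet> z) \<partial>\<mu> n) \<longlonglongrightarrow> (\<integral>z. tail_ramp R (c \<bullet> z) \<partial>\<nu>)"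
proof -
  interpret \<mu>: prob_space "\<mu> n" for n by fact
  interpret \<nu>: prob_space \<nu> by fact
  let ?m = "\<lambda>n. distr (\<mu> n) borel (\<lambda>z. c \<bullet> z)" and ?n = "distr \<nu> borel (\<lambda>z. c \<bullet> z)"
  have rd: "real_distribution (?m n)" "real_distribution ?n" for n
    by (auto intro!: \<mu>.real_distribution_distr \<nu>.real_distribution_distr)
  have weak: "weak_conv_m ?m ?n"
    by (rule levy_continuity) (use rd conv sets in \<open>auto simp: char_distr_inner\<close>)
  have "(\<lambda>n. integral\<^sup>L (?m n) (tail_ramp R)) \<longlonglongrightarrow> integral\<^sup>L ?n (tail_ramp R)"
  proof (rule weak_conv_imp_integral_bdd_continuous_conv[OF rd weak])
    show "isCont (tail_ramp R) x" for x
      using continuous_tail_ramp[of UNIV "\<lambda>x. x" R] by (simp add: continuous_on_eq_continuous_at)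
  qed (use tail_ramp_bounds in auto)
  then show ?thesis by (simp add: integral_distr)
qed

lemma marginal_tail_vanishes:
  fixes \<nu> :: "complex measure"
  assumes prob: "prob_space \<nu>" and sets [measurable_cong]: "sets \<nu> = sets borel"
  shows "(\<lambda>k. \<integral>z. tail_ramp (real k) (c \<bullet> z) \<partial>\<nu>) \<longlonglongrightarrow> 0"
proof -
  interpret prob_space \<nu> by fact
  have meas: "(\<lambda>z. tail_ramp R (c \<bullet> z)) \<in> borel_measurable \<nu>" for R by measurable
  have "(\<lambda>k. \<integral>z. tail_ramp (real k) (c \<bullet> z) \<partial>\<nu>) \<longlonglongrightarrow> (\<integral>z. 0 \<partial>\<nu>)"
  proof (rule integral_dominated_convergence[where w="\<lambda>_. 1"])
    show "AE z in \<nu>. (\<lambda>k. tail_ramp (real k) (c \<bullet> z)) \<longlonglongrightarrow> 0"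
    proof (intro always_eventually allI)
      fix z
      have "eventually (\<lambda>k. tail_ramp (real k) (c \<bullet> z) = 0) sequentially"
        using eventually_ge_at_top[of "nat \<lceil>\<bar>c \<bullet> z\<bar>\<rceil>"]
        by eventually_elim (auto simp: tail_ramp_def nat_le_iff ceiling_le_iff)
      then show "(\<lambda>k. tail_ramp (real k) (c \<bullet> z)) \<longlonglongrightarrow> 0" by (rule tendsto_eventually)
    qed
  qed (auto simp: tail_ramp_bounds intro: meas)
  then show ?thesis by simp
qed

text \<open>Cut \<open>f\<close> off outside a large square and replace the result by a periodic trigonometric
polynomial \<open>g\<close>. The integral of \<open>g\<close> is a finite combination of values of the
characteristic function, hence converges. The error \<open>f - g\<close> is small on the square and bounded
elsewhere, so that it is dominated by a multiple of the tail function \<open>w\<close>, whose integrals are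
uniformly small by convergence of the two marginals.\<close>
theorem planar_levy_continuity:
  fixes f :: "complex \<Rightarrow> real"
  assumes prob: "\<And>n. prob_space (\<mu> n)" "prob_space \<nu>"
    and sets [measurable_cong]: "\<And>n. sets (\<mu> n) = sets borel" "sets \<nu> = sets borel"
    and conv: "\<And>c. (\<lambda>n. planar_char (\<mu> n) c) \<longlonglongrightarrow> planar_char \<nu> c"
    and f: "continuous_on UNIV f" "bounded (range f)"
  shows "(\<lambda>n. \<integral>z. f z \<partial>\<mu> n) \<longlonglongrightarrow> (\<integral>z. f z \<partial>\<nu>)"
proof (rule LIMSEQ_I)
  fix \<epsilon> :: real assume "0 < \<epsilon>"
  interpret \<mu>: prob_space "\<mu> n" for n by fact
  interpret \<nu>: prob_space \<nu> by fact
  obtain C where C: "0 < C" "\<And>z. \<bar>f z\<bar> \<le> C"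
    using f(2) by (auto simp: bounded_pos)
  have [measurable]: "f \<in> borel_measurable borel"
    using f(1) by (rule borel_measurable_continuous_onI)
  define w where "w k z = tail_ramp (real k) (1 \<bullet> z) + tail_ramp (real k) (\<i> \<bullet> z)" for k and z :: complex
  have w_meas [measurable]: "w k \<in> borel_measurable borel" for k
    unfolding w_def by measurable
  have w_bound: "0 \<le> w k z" "w k z \<le> 2" for k z
    using tail_ramp_bounds(1,2)[of k "1 \<bullet> z"] tail_ramp_bounds(1,2)[of k "\<i> \<bullet> z"] by (auto simp: w_def)
  have ramp_int: "integrable (\<mu> n) (\<lambda>z. tail_ramp R (c \<bullet> z))" "integrable \<nu> (\<lambda>z. tail_ramp R (c \<bullet> z))" for n R c
    by (auto intro!: \<mu>.integrable_const_bound[where B=1] \<nu>.integrable_const_bound[where B=1] simp: tail_ramp_bounds)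
  have w_int: "integrable (\<mu> n) (w k)" "integrable \<nu> (w k)" for n k
    unfolding w_def by (intro Bochner_Integration.integrable_add ramp_int)+
  have "(\<lambda>k. \<integral>z. w k z \<partial>\<nu>) \<longlonglongrightarrow> 0 + 0"
    unfolding w_def Bochner_Integration.integral_add[OF ramp_int(2) ramp_int(2)]
    by (intro tendsto_add marginal_tail_vanishes[OF prob(2) sets(2)])
  then have "eventually (\<lambda>k. (\<integral>z. w k z \<partial>\<nu>) < \<epsilon> / (32 * C)) sequentially"
    by (rule order_tendstoD) (use \<open>0 < \<epsilon>\<close> C in auto)
  then obtain k where k: "(\<integral>z. w k z \<partial>\<nu>) < \<epsilon> / (32 * C)"
    by (auto simp: eventually_sequentially)
  have w_lim: "(\<lambda>n. \<integral>z. w k z \<partial>\<mu> n) \<longlonglongrightarrow> (\<integral>z. w k z \<partial>\<nu>)"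
    unfolding w_def
    by (simp only: Bochner_Integration.integral_add[OF ramp_int(1) ramp_int(1)]
        Bochner_Integration.integral_add[OF ramp_int(2) ramp_int(2)])
      (intro tendsto_add marginal_tail_converges prob sets conv)
  define h where "h z = f z * ((1 - tail_ramp k (1 \<bullet> z)) * (1 - tail_ramp k (\<i> \<bullet> z)))" for z
  have coef: "0 \<le> (1 - tail_ramp k (1 \<bullet> z)) * (1 - tail_ramp k (\<i> \<bullet> z))"
    "(1 - tail_ramp k (1 \<bullet> z)) * (1 - tail_ramp k (\<i> \<bullet> z)) \<le> 1"
    "1 - (1 - tail_ramp k (1 \<bullet> z)) * (1 - tail_ramp k (\<i> \<bullet> z)) \<le> w k z" for z
  proof -
    let ?a = "tail_ramp k (1 \<bullet> z)" and ?b = "tail_ramp k (\<i> \<bullet> z)"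
    note ab = tail_ramp_bounds(1,2)[of k "1 \<bullet> z"] tail_ramp_bounds(1,2)[of k "\<i> \<bullet> z"]
    show "0 \<le> (1 - ?a) * (1 - ?b)" using ab by simp
    show "(1 - ?a) * (1 - ?b) \<le> 1" using ab by (intro mult_le_one) auto
    have "0 \<le> ?a * ?b" using ab by simp
    then show "1 - (1 - ?a) * (1 - ?b) \<le> w k z" by (simp add: w_def algebra_simps)
  qed
  have h_bound: "\<bar>h z\<bar> \<le> C" for z
    using mult_mono[OF C(2)[of z] coef(2)[of z]] coef(1)[of z] C(1)
    unfolding h_def abs_mult[of "f z"] abs_of_nonneg[OF coef(1)] by simp
  have fh: "\<bar>f z - h z\<bar> \<le> C * w k z" for z
  proof -
    have "f z - h z = f z * (1 - (1 - tail_ramp k (1 \<bullet> z)) * (1 - tail_ramp k (\<i> \<bullet> z)))"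
      by (simp add: h_def algebra_simps)
    also have "\<bar>\<dots>\<bar> = \<bar>f z\<bar> * (1 - (1 - tail_ramp k (1 \<bullet> z)) * (1 - tail_ramp k (\<i> \<bullet> z)))"
      using coef(2)[of z] by (simp add: abs_mult)
    also have "\<dots> \<le> C * w k z"
      using C coef[of z] by (intro mult_mono) auto
    finally show ?thesis .
  qed
  define K where "K = real k + 1"
  obtain g where g: "trig_poly (\<lambda>z. complex_of_real (g z))"
    "\<And>z. \<bar>Re z\<bar> \<le> K \<Longrightarrow> \<bar>Im z\<bar> \<le> K \<Longrightarrow> \<bar>h z - g z\<bar> < \<epsilon>/8" "\<And>z. \<bar>g z\<bar> \<le> C + \<epsilon>/8"
  proof (rule periodic_trig_approximation[of K "\<epsilon>/8" h C])
    show "continuous_on UNIV h" unfolding h_def by (intro continuous_intros f)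
    show "h z = 0" if "\<bar>Re z\<bar> = K \<or> \<bar>Im z\<bar> = K" for z
      using that by (auto simp: h_def tail_ramp_def K_def inner_complex_def)
  qed (use \<open>0 < \<epsilon>\<close> h_bound in \<open>auto simp: K_def\<close>)
  have fg: "\<bar>f z - g z\<bar> \<le> 2 * C * w k z + \<epsilon>/8" for z
  proof (cases "\<bar>Re z\<bar> \<le> K \<and> \<bar>Im z\<bar> \<le> K")
    case True
    moreover have "0 \<le> C * w k z" using C w_bound by simp
    ultimately show ?thesis using fh[of z] g(2)[of z] by linarith
  next
    case False
    then have "1 \<le> w k z"
      using tail_ramp_bounds(1)[of k "1 \<bullet> z"] tail_ramp_bounds(1)[of k "\<i> \<bullet> z"]
      by (auto simp: w_def tail_ramp_def K_def inner_complex_def)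
    then have "C * 1 \<le> C * w k z" using C by (intro mult_left_mono) auto
    then show ?thesis using C(2)[of z] g(3)[of z] by linarith
  qed
  have g_meas [measurable]: "g \<in> borel_measurable borel"
    using measurable_compose[OF conjunct1[OF trig_poly_bounded_measurable[OF g(1)]] borel_measurable_Re] by simp
  have approx: "\<bar>(\<integral>z. f z \<partial>P) - (\<integral>z. g z \<partial>P)\<bar> \<le> 2 * C * (\<integral>z. w k z \<partial>P) + \<epsilon>/8"
    if "prob_space P" and [measurable_cong]: "sets P = sets borel" and wP: "integrable P (w k)" for P
  proof -
    interpret P: prob_space P by fact
    have fi: "integrable P f" by (rule P.integrable_const_bound[where B=C]) (use C in auto)
    have gi: "integrable P g" by (rule P.integrable_const_bound[where B="C+\<epsilon>/8"]) (use g in auto)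
    have "\<bar>(\<integral>z. f z \<partial>P) - (\<integral>z. g z \<partial>P)\<bar> = \<bar>\<integral>z. f z - g z \<partial>P\<bar>"
      using fi gi by simp
    also have "\<dots> \<le> (\<integral>z. \<bar>f z - g z\<bar> \<partial>P)" by (rule integral_abs_bound)
    also have "\<dots> \<le> (\<integral>z. 2 * C * w k z + \<epsilon>/8 \<partial>P)"
      using fi gi wP fg by (intro integral_mono) auto
    also have "\<dots> = 2 * C * (\<integral>z. w k z \<partial>P) + \<epsilon>/8"
      using wP by (simp add: P.prob_space)
    finally show ?thesis .
  qed
  have "(\<lambda>n. \<integral>z. complex_of_real (g z) \<partial>\<mu> n) \<longlonglongrightarrow> (\<integral>z. complex_of_real (g z) \<partial>\<nu>)"
    by (rule trig_poly_integral_converges[OF prob sets conv g(1)])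
  then have "(\<lambda>n. \<integral>z. g z \<partial>\<mu> n) \<longlonglongrightarrow> (\<integral>z. g z \<partial>\<nu>)"
    by (simp add: tendsto_of_real_iff)
  then have "eventually (\<lambda>n. \<bar>(\<integral>z. g z \<partial>\<mu> n) - (\<integral>z. g z \<partial>\<nu>)\<bar> < \<epsilon>/8) sequentially"
    unfolding tendsto_iff dist_real_def using \<open>0 < \<epsilon>\<close> by (drule_tac x="\<epsilon>/8" in spec) simp
  moreover have "eventually (\<lambda>n. (\<integral>z. w k z \<partial>\<mu> n) < \<epsilon> / (16 * C)) sequentially"
    by (rule order_tendstoD[OF w_lim]) (rule less_le_trans[OF k], use \<open>0 < \<epsilon>\<close> C in \<open>auto simp: field_simps\<close>)
  ultimately have "eventually (\<lambda>n. norm ((\<integral>z. f z \<partial>\<mu> n) - (\<integral>z. f z \<partial>\<nu>)) < \<epsilon>) sequentially"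
  proof eventually_elim
    case (elim n)
    have "2 * C * (\<integral>z. w k z \<partial>\<mu> n) < \<epsilon>/8" "2 * C * (\<integral>z. w k z \<partial>\<nu>) < \<epsilon>/8"
      using elim(2) k C \<open>0 < \<epsilon>\<close> by (simp_all add: field_simps)
    then show ?case
      using elim(1) approx[OF prob(1) sets(1) w_int(1), of n] approx[OF prob(2) sets(2) w_int(2)]
        \<open>0 < \<epsilon>\<close> unfolding real_norm_def by linarith
  qed
  then show "\<exists>no. \<forall>n\<ge>no. norm ((\<integral>z. f z \<partial>\<mu> n) - (\<integral>z. f z \<partial>\<nu>)) < \<epsilon>"
    by (simp add: eventually_sequentially)
qed

text \<open>Constant sequences in the continuity theorem show that both measures integrate bounded continuous
functions equally; such functions decrease to indicators of closed sets, which generate the Borel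
sets.\<close>
theorem planar_char_unique:
  assumes prob: "prob_space \<mu>" "prob_space \<nu>"
    and sets [measurable_cong]: "sets \<mu> = sets borel" "sets \<nu> = sets borel"
    and eq: "\<And>c. planar_char \<mu> c = planar_char \<nu> c"
  shows "\<mu> = \<nu>"
proof -
  interpret \<mu>: prob_space \<mu> by fact
  interpret \<nu>: prob_space \<nu> by fact
  have int_eq: "(\<integral>z. f z \<partial>\<mu>) = (\<integral>z. f z \<partial>\<nu>)"
    if "continuous_on UNIV f" "bounded (range f)" for f :: "complex \<Rightarrow> real"
    using planar_levy_continuity[of "\<lambda>_. \<mu>" \<nu> f] prob sets eq that by (simp add: LIMSEQ_const_iff)
  have closed_eq: "measure \<mu> F = measure \<nu> F" if F: "closed F" "F \<noteq> {}" for F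
  proof -
    define b where "b k z = max 0 (1 - real k * infdist z F)" for k z
    have cont: "continuous_on UNIV (b k)" for k
      unfolding b_def by (intro continuous_intros)
    have b01: "0 \<le> b k z" "b k z \<le> 1" for k z by (auto simp: b_def infdist_nonneg)
    have [measurable]: "b k \<in> borel_measurable borel" for k
      using cont by (rule borel_measurable_continuous_onI)
    have [measurable]: "F \<in> sets borel" using F by simp
    have lim: "(\<lambda>k. \<integral>z. b k z \<partial>P) \<longlonglongrightarrow> measure P F"
      if "prob_space P" and [measurable_cong]: "sets P = sets borel" for P
    proof -
      interpret P: prob_space P by fact
      have "(\<lambda>k. \<integral>z. b k z \<partial>P) \<longlonglongrightarrow> (\<integral>z. indicator F z \<partial>P)"
      proof (rule integral_dominated_convergence[where w="\<lambda>_. 1"])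
        show "AE z in P. (\<lambda>k. b k z) \<longlonglongrightarrow> indicator F z"
        proof (intro always_eventually allI)
          fix z
          show "(\<lambda>k. b k z) \<longlonglongrightarrow> indicator F z"
          proof (cases "z \<in> F")
            case True
            then show ?thesis by (simp add: b_def)
          next
            case False
            then have pos: "0 < infdist z F"
              using F in_closed_iff_infdist_zero[of F z] infdist_nonneg[of z F] by (auto simp: less_le)
            have "eventually (\<lambda>k. b k z = 0) sequentially"
              using eventually_ge_at_top[of "nat \<lceil>1 / infdist z F\<rceil>"]
            proof eventually_elim
              case (elim k)
              then have "1 / infdist z F \<le> real k" by (simp add: nat_le_iff ceiling_le_iff)
              then show ?case using pos by (simp add: b_def field_simps)
            qed
            then show ?thesis using False by (simp add: tendsto_eventually)
          qed
        qed
      qed (use b01 in auto)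
      then show ?thesis using sets_eq_imp_space_eq[OF that(2)] by simp
    qed
    have "(\<integral>z. b k z \<partial>\<mu>) = (\<integral>z. b k z \<partial>\<nu>)" for k
      using b01 by (intro int_eq cont) (auto simp: bounded_iff intro!: exI[of _ 1])
    then show ?thesis
      using lim[OF prob(1) sets(1)] lim[OF prob(2) sets(2)] by (auto intro: LIMSEQ_unique)
  qed
  show ?thesis
  proof (rule measure_eqI_generator_eq)
    show "Int_stable {F :: complex set. closed F}" by (auto simp: Int_stable_def)
    show "emeasure \<mu> F = emeasure \<nu> F" if "F \<in> {F. closed F}" for F
      using closed_eq[of F] that by (cases "F = {}") (auto simp: \<mu>.emeasure_eq_measure \<nu>.emeasure_eq_measure)
    show "sets \<mu> = sigma_sets UNIV {F. closed F}" "sets \<nu> = sigma_sets UNIV {F. closed F}"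
      using sets by (simp_all add: borel_eq_closed)
    show "range (\<lambda>_::nat. UNIV) \<subseteq> {F :: complex set. closed F}" by auto
  qed auto
qed

section \<open>Planar Gaussian laws and their characteristic functions\<close>

abbreviation std_gauss :: "real measure" where "std_gauss \<equiv> std_normal_distribution"

interpretation std_gauss: prob_space std_gauss
  by (rule prob_space_normal_density) simp

interpretation std_gauss2: pair_prob_space std_gauss std_gauss ..

lemma integrable_product_mult:
  fixes f :: "'a \<Rightarrow> complex" and g :: "'b \<Rightarrow> complex"
  assumes "sigma_finite_measure M1" "sigma_finite_measure M2"
    and f: "integrable M1 f" and g: "integrable M2 g"
  shows "integrable (M1 \<Otimes>\<^sub>M M2) (\<lambda>p. f (fst p) * g (snd p))"
    and "(\<integral>p. f (fst p) * g (snd p) \<partial>(M1 \<Otimes>\<^sub>M M2)) = (\<integral>x. f x \<partial>M1) * (\<integral>y. g y \<partial>M2)"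
proof -
  interpret pair_sigma_finite M1 M2 by (intro pair_sigma_finite.intro assms)
  have [measurable]: "f \<in> borel_measurable M1" "g \<in> borel_measurable M2" using f g by auto
  show int: "integrable (M1 \<Otimes>\<^sub>M M2) (\<lambda>p. f (fst p) * g (snd p))"
    by (rule Fubini_integrable) (use f g in \<open>auto simp: norm_mult\<close>)
  show "(\<integral>p. f (fst p) * g (snd p) \<partial>(M1 \<Otimes>\<^sub>M M2)) = (\<integral>x. f x \<partial>M1) * (\<integral>y. g y \<partial>M2)"
    using integral_fst'[OF int] by simp
qed

lemma cis_std_gauss: "(\<integral>x. cis (t * x) \<partial>std_gauss) = complex_of_real (exp (- t\<^sup>2 / 2))"
  using char_std_normal_distribution by (simp add: char_def cis_conv_exp fun_eq_iff)

lemma integrable_cis: "prob_space M \<Longrightarrow> f \<in> borel_measurable M \<Longrightarrow> integrable M (\<lambda>x. cis (f x))"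
  by (intro finite_measure.integrable_const_bound[where B=1] prob_space.finite_measure)
     (auto simp: cis_conv_exp)

text \<open>The joint law, with the plane identified with \<open>complex\<close>, of standard normal variables of
correlation \<open>\<rho>\<close>. It is built from two independent normals, so that the degenerate cases
\<open>\<rho> = 1\<close> and \<open>\<rho> = - 1\<close>, in which no planar density exists, are included.\<close>
definition gauss_plane :: "real \<Rightarrow> complex measure" where
  "gauss_plane \<rho> = distr (std_gauss \<Otimes>\<^sub>M std_gauss) borel
     (\<lambda>p. Complex (fst p) (\<rho> * fst p + sqrt (1 - \<rho>\<^sup>2) * snd p))"

lemma measurable_Complex [measurable (raw)]:
  assumes [measurable]: "f \<in> borel_measurable M" "g \<in> borel_measurable M"
  shows "(\<lambda>x. Complex (f x) (g x)) \<in> borel_measurable M"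
  by (subst borel_measurable_complex_iff) simp

lemma planar_char_gauss_plane:
  assumes "\<bar>\<rho>\<bar> \<le> 1"
  shows "planar_char (gauss_plane \<rho>) c =
    exp (- ((Re c)\<^sup>2 + 2 * \<rho> * Re c * Im c + (Im c)\<^sup>2) / 2)"
proof -
  let ?s = "sqrt (1 - \<rho>\<^sup>2)"
  have s: "?s\<^sup>2 = 1 - \<rho>\<^sup>2" using assms by (simp add: abs_square_le_1)
  have "planar_char (gauss_plane \<rho>) c =
      (\<integral>p. cis ((Re c + Im c * \<rho>) * fst p) * cis ((Im c * ?s) * snd p) \<partial>(std_gauss \<Otimes>\<^sub>M std_gauss))"
    unfolding gauss_plane_def
    by (subst planar_char_distr) (auto simp: inner_complex_def cis_mult algebra_simps)
  also have "\<dots> = (\<integral>x. cis ((Re c + Im c * \<rho>) * x) \<partial>std_gauss) * (\<integral>y. cis ((Im c * ?s) * y) \<partial>std_gauss)"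
    by (intro integrable_product_mult integrable_cis std_gauss.sigma_finite_measure_axioms std_gauss.prob_space_axioms) auto
  also have "\<dots> = complex_of_real (exp (- (Re c + Im c * \<rho>)\<^sup>2 / 2 + - (Im c * ?s)\<^sup>2 / 2))"
    unfolding cis_std_gauss exp_add by simp
  also have "- (Re c + Im c * \<rho>)\<^sup>2 / 2 + - (Im c * ?s)\<^sup>2 / 2 = - ((Re c)\<^sup>2 + 2 * \<rho> * Re c * Im c + (Im c)\<^sup>2) / 2"
    unfolding power_mult_distrib s by (simp add: power2_eq_square field_simps)
  finally show ?thesis by simp
qed

lemma char_normal_density:
  assumes "0 < s"
  shows "char (density lborel (normal_density 0 s)) t = exp (- (s * t)\<^sup>2 / 2)"
proof -
  have d: "s * normal_density 0 s (s * x) = std_normal_density x" for x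
    using assms by (simp add: normal_density_def real_sqrt_mult power_mult_distrib field_simps)
  have "char (density lborel (normal_density 0 s)) t
      = (\<integral>x. normal_density 0 s x *\<^sub>R iexp (t * x) \<partial>lborel)"
    unfolding char_def by (subst integral_density) auto
  also have "\<dots> = s *\<^sub>R (\<integral>x. normal_density 0 s (s * x) *\<^sub>R iexp (t * (s * x)) \<partial>lborel)"
    using assms lborel_integral_real_affine[of s "\<lambda>x. normal_density 0 s x *\<^sub>R iexp (t * x)" 0] by simp
  also have "\<dots> = (\<integral>x. std_normal_density x *\<^sub>R iexp (s * t * x) \<partial>lborel)"
    unfolding d[symmetric] using assms
    by (subst integral_scaleR_right[symmetric]) (simp add: mult_ac)
  also have "\<dots> = char std_gauss (s * t)"
    unfolding char_def by (subst integral_density) auto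
  finally show ?thesis by (simp add: char_std_normal_distribution)
qed

text \<open>Only the first two moments enter, and the formula covers point masses as Gaussians of variance 0.\<close>
lemma char_gaussian_law:
  assumes D: "gaussian_law D" and mean: "(\<integral>x. x \<partial>D) = 0" and var: "(\<integral>x. x\<^sup>2 \<partial>D) = v"
  shows "char D 1 = exp (- v / 2)"
  using D unfolding gaussian_law_def
proof (elim disjE exE conjE)
  fix m assume "D = return borel m"
  then show ?thesis using mean var by (simp add: char_def integral_return)
next
  fix m s :: real assume s: "0 < s" and D: "D = density lborel (\<lambda>x. ennreal (normal_density m s x))"
  have "(\<integral>x. x \<partial>D) = (\<integral>x. normal_density m s x * x \<partial>lborel)"
    unfolding D by (subst integral_density) auto
  then have m: "m = 0" using mean integral_normal_moment_nz_1[OF s, of m] by simp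
  have "(\<integral>x. x\<^sup>2 \<partial>D) = (\<integral>x. normal_density 0 s x * (x - 0)^(2 * 1) \<partial>lborel)"
    unfolding D m by (subst integral_density) auto
  then have "v = s\<^sup>2"
    using integral_normal_moment_even[OF s, of 0 1] var by simp
  then show ?thesis using char_normal_density[OF s, of 1] by (simp add: D m)
qed

text \<open>Every linear combination of \<open>X\<close> and \<open>Y\<close> is a centred Gaussian whose variance is determined by
\<open>\<rho>\<close>, which fixes the planar characteristic function. This turns the hypothesis on linear
combinations into an explicit coupling with two independent normals.\<close>
theorem bivariate_gaussian_law:
  assumes M: "prob_space M" and XY: "bivariate_gaussian M X Y"
    and mean: "integral\<^sup>L M X = 0" "integral\<^sup>L M Y = 0"
    and var: "prob_space.variance M X = 1" "prob_space.variance M Y = 1"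
    and corr: "correlation M X Y = \<rho>" and \<rho>: "\<bar>\<rho>\<bar> \<le> 1"
  shows "distr M borel (\<lambda>\<omega>. Complex (X \<omega>) (Y \<omega>)) = gauss_plane \<rho>"
proof (rule planar_char_unique)
  interpret prob_space M by fact
  have [measurable]: "X \<in> borel_measurable M" "Y \<in> borel_measurable M"
    using XY by (auto simp: bivariate_gaussian_def)
  have var': "expectation (\<lambda>\<omega>. (X \<omega>)\<^sup>2) = 1" "expectation (\<lambda>\<omega>. (Y \<omega>)\<^sup>2) = 1"
    using var mean by auto
  \<comment> \<open>Square integrability is forced by the variance: the integral of a non-integrable function is 0.\<close>
  then have sq: "integrable M (\<lambda>\<omega>. (X \<omega>)\<^sup>2)" "integrable M (\<lambda>\<omega>. (Y \<omega>)\<^sup>2)"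
    using not_integrable_integral_eq by force+
  then have int: "integrable M X" "integrable M Y"
    by (auto intro: square_integrable_imp_integrable)
  have XY_int: "integrable M (\<lambda>\<omega>. X \<omega> * Y \<omega>)"
  proof (rule Bochner_Integration.integrable_bound[OF Bochner_Integration.integrable_add[OF sq]])
    have "\<bar>X \<omega> * Y \<omega>\<bar> \<le> (X \<omega>)\<^sup>2 + (Y \<omega>)\<^sup>2" for \<omega>
      using sum_squares_bound[of "\<bar>X \<omega>\<bar>" "\<bar>Y \<omega>\<bar>"] abs_ge_zero[of "X \<omega> * Y \<omega>"]
      unfolding abs_mult power2_abs by linarith
    then show "AE \<omega> in M. norm (X \<omega> * Y \<omega>) \<le> norm ((X \<omega>)\<^sup>2 + (Y \<omega>)\<^sup>2)" by simp
  qed simp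
  have cov: "expectation (\<lambda>\<omega>. X \<omega> * Y \<omega>) = \<rho>"
    using corr var mean by (simp add: correlation_def covariance_def)
  show "planar_char (distr M borel (\<lambda>\<omega>. Complex (X \<omega>) (Y \<omega>))) c = planar_char (gauss_plane \<rho>) c" for c
  proof -
    let ?D = "distr M borel (\<lambda>\<omega>. Re c * X \<omega> + Im c * Y \<omega>)"
    have "planar_char (distr M borel (\<lambda>\<omega>. Complex (X \<omega>) (Y \<omega>))) c = char ?D 1"
      by (simp add: planar_char_distr char_def integral_distr inner_complex_def cis_conv_exp)
    also have "\<dots> = exp (- ((Re c)\<^sup>2 + 2 * \<rho> * Re c * Im c + (Im c)\<^sup>2) / 2)"
    proof (rule char_gaussian_law)
      show "gaussian_law ?D" using XY by (simp add: bivariate_gaussian_def)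
      show "(\<integral>x. x \<partial>?D) = 0" using int mean by (simp add: integral_distr)
      have "(\<integral>x. x\<^sup>2 \<partial>?D) = expectation (\<lambda>\<omega>. (Re c)\<^sup>2 * (X \<omega>)\<^sup>2 + (2 * Re c * Im c) * (X \<omega> * Y \<omega>) + (Im c)\<^sup>2 * (Y \<omega>)\<^sup>2)"
        by (subst integral_distr) (auto simp: power2_eq_square algebra_simps intro!: Bochner_Integration.integral_cong)
      also have "\<dots> = (Re c)\<^sup>2 + 2 * \<rho> * Re c * Im c + (Im c)\<^sup>2"
        using sq XY_int var' cov by simp
      finally show "(\<integral>x. x\<^sup>2 \<partial>?D) = (Re c)\<^sup>2 + 2 * \<rho> * Re c * Im c + (Im c)\<^sup>2" .
    qed
    finally show ?thesis using planar_char_gauss_plane[OF \<rho>] by simp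
  qed
  show "prob_space (distr M borel (\<lambda>\<omega>. Complex (X \<omega>) (Y \<omega>)))"
    by (rule prob_space_distr) simp
  show "prob_space (gauss_plane \<rho>)"
    unfolding gauss_plane_def by (rule std_gauss2.prob_space_distr) simp
qed (simp_all add: gauss_plane_def)

lemma lborel_complex: "(lborel :: complex measure) = distr (lborel \<Otimes>\<^sub>M lborel) borel (\<lambda>p. Complex (fst p) (snd p))"
proof (rule lborel_eqI)
  fix l u :: complex assume lu: "\<And>b. b \<in> Basis \<Longrightarrow> l \<bullet> b \<le> u \<bullet> b"
  have le: "Re l \<le> Re u" "Im l \<le> Im u" using lu[of 1] lu[of \<i>] by (auto simp: Basis_complex_def)
  have pre: "(\<lambda>p. Complex (fst p) (snd p)) -` box l u \<inter> space (lborel \<Otimes>\<^sub>M lborel) = {Re l<..<Re u} \<times> {Im l<..<Im u}"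
    by (auto simp: in_box_complex_iff space_pair_measure)
  show "emeasure (distr (lborel \<Otimes>\<^sub>M lborel) borel (\<lambda>p. Complex (fst p) (snd p))) (box l u)
      = ennreal (\<Prod>b\<in>Basis. (u - l) \<bullet> b)"
    by (subst emeasure_distr)
      (auto simp: pre lborel.emeasure_pair_measure_Times Basis_complex_def le ennreal_mult)
qed simp

lemma complex_normal_eq_distr:
  assumes s: "0 < s"
  shows "complex_normal (2 * s\<^sup>2) =
    distr (density lborel (normal_density 0 s) \<Otimes>\<^sub>M density lborel (normal_density 0 s)) borel
      (\<lambda>p. Complex (fst p) (snd p))"
proof -
  let ?g = "\<lambda>z::complex. ennreal (1 / (pi * (2 * s\<^sup>2)) * exp (- (cmod (z / complex_of_real (sqrt (2 * s\<^sup>2))))\<^sup>2))"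
  have g: "?g (Complex x y) = ennreal (normal_density 0 s x) * ennreal (normal_density 0 s y)" for x y
  proof -
    have "(cmod (Complex x y / complex_of_real (sqrt (2 * s\<^sup>2))))\<^sup>2 = (x\<^sup>2 + y\<^sup>2) / (2 * s\<^sup>2)"
      by (simp add: norm_divide power_divide cmod_power2)
    moreover have "normal_density 0 s x * normal_density 0 s y
        = 1 / (sqrt (2 * pi * s\<^sup>2) * sqrt (2 * pi * s\<^sup>2)) * (exp (- x\<^sup>2 / (2 * s\<^sup>2)) * exp (- y\<^sup>2 / (2 * s\<^sup>2)))"
      by (simp add: normal_density_def)
    moreover have "sqrt (2 * pi * s\<^sup>2) * sqrt (2 * pi * s\<^sup>2) = pi * (2 * s\<^sup>2)"
      by (subst real_sqrt_mult_self) (simp add: abs_mult)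
    moreover have "exp (- x\<^sup>2 / (2 * s\<^sup>2)) * exp (- y\<^sup>2 / (2 * s\<^sup>2)) = exp (- ((x\<^sup>2 + y\<^sup>2) / (2 * s\<^sup>2)))"
      by (simp add: exp_add[symmetric] add_divide_distrib)
    ultimately have "1 / (pi * (2 * s\<^sup>2)) * exp (- (cmod (Complex x y / complex_of_real (sqrt (2 * s\<^sup>2))))\<^sup>2)
        = normal_density 0 s x * normal_density 0 s y"
      by simp
    then show ?thesis by (simp add: ennreal_mult)
  qed
  have "complex_normal (2 * s\<^sup>2) = density (distr (lborel \<Otimes>\<^sub>M lborel) borel (\<lambda>p. Complex (fst p) (snd p))) ?g"
    unfolding complex_normal_def lborel_complex[symmetric] ..
  also have "\<dots> = distr (density (lborel \<Otimes>\<^sub>M lborel) (\<lambda>p. ?g (Complex (fst p) (snd p)))) borel (\<lambda>p. Complex (fst p) (snd p))"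
    by (rule density_distr) auto
  also have "density (lborel \<Otimes>\<^sub>M lborel) (\<lambda>p. ?g (Complex (fst p) (snd p)))
      = density lborel (normal_density 0 s) \<Otimes>\<^sub>M density lborel (normal_density 0 s)"
    unfolding g using s
    by (subst pair_measure_density) (auto simp: case_prod_unfold intro!: prob_space_imp_sigma_finite prob_space_normal_density lborel.sigma_finite_measure_axioms)
  finally show ?thesis .
qed

lemma prob_space_complex_normal: "0 < s \<Longrightarrow> prob_space (complex_normal (2 * s\<^sup>2))"
  unfolding complex_normal_eq_distr
  by (intro prob_space.prob_space_distr prob_space_pair prob_space_normal_density) auto

lemma planar_char_complex_normal:
  assumes s: "0 < s"
  shows "planar_char (complex_normal (2 * s\<^sup>2)) c = exp (- (s * cmod c)\<^sup>2 / 2)"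
proof -
  let ?N = "density lborel (normal_density 0 s)"
  have N: "prob_space ?N" using s by (rule prob_space_normal_density)
  have cis_N: "(\<integral>x. cis (t * x) \<partial>?N) = exp (- (s * t)\<^sup>2 / 2)" for t
    using char_normal_density[OF s, of t] by (simp add: char_def cis_conv_exp)
  have "planar_char (complex_normal (2 * s\<^sup>2)) c = (\<integral>p. cis (Re c * fst p) * cis (Im c * snd p) \<partial>(?N \<Otimes>\<^sub>M ?N))"
    unfolding complex_normal_eq_distr[OF s]
    by (subst planar_char_distr) (auto simp: inner_complex_def cis_mult)
  also have "\<dots> = (\<integral>x. cis (Re c * x) \<partial>?N) * (\<integral>y. cis (Im c * y) \<partial>?N)"
    by (intro integrable_product_mult integrable_cis prob_space_imp_sigma_finite N) auto
  also have "\<dots> = complex_of_real (exp (- (s * Re c)\<^sup>2 / 2 + - (s * Im c)\<^sup>2 / 2))"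
    unfolding cis_N exp_add by simp
  also have "- (s * Re c)\<^sup>2 / 2 + - (s * Im c)\<^sup>2 / 2 = - (s * cmod c)\<^sup>2 / 2"
    by (simp add: power_mult_distrib cmod_power2 field_simps)
  finally show ?thesis .
qed

section \<open>Exponential tilting and half-line integrals of the Gaussian\<close>

lemma std_gauss_integrable_iff:
  fixes f :: "real \<Rightarrow> 'a::{banach, second_countable_topology}"
  assumes [measurable]: "f \<in> borel_measurable borel"
  shows "integrable std_gauss f \<longleftrightarrow> integrable lborel (\<lambda>x. std_normal_density x *\<^sub>R f x)"
  by (subst integrable_density) auto

lemma std_gauss_integral:
  fixes f :: "real \<Rightarrow> 'a::{banach, second_countable_topology}"
  assumes [measurable]: "f \<in> borel_measurable borel"
  shows "(\<integral>x. f x \<partial>std_gauss) = (\<integral>x. std_normal_density x *\<^sub>R f x \<partial>lborel)"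
  by (subst integral_density) auto

lemma std_normal_density_shift:
  "std_normal_density (a + x) * exp (a * (a + x)) = exp (a\<^sup>2 / 2) * std_normal_density x"
proof -
  have "- (a + x)\<^sup>2 / 2 + a * (a + x) = a\<^sup>2 / 2 + - x\<^sup>2 / 2"
    by (simp add: power2_eq_square field_simps)
  then have "exp (- (a + x)\<^sup>2 / 2) * exp (a * (a + x)) = exp (a\<^sup>2 / 2) * exp (- x\<^sup>2 / 2)"
    unfolding exp_add[symmetric] by (rule arg_cong)
  then show ?thesis unfolding std_normal_density_def by (simp add: mult_ac)
qed

lemma gauss_tilt_integrable:
  fixes g :: "real \<Rightarrow> 'a::{banach, second_countable_topology}"
  assumes [measurable]: "g \<in> borel_measurable borel"
    and g: "integrable std_gauss (\<lambda>x. g (a + x))"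
  shows "integrable std_gauss (\<lambda>x. exp (a * x) *\<^sub>R g x)"
proof -
  have "integrable lborel (\<lambda>x. exp (a\<^sup>2 / 2) *\<^sub>R (std_normal_density x *\<^sub>R g (a + x)))"
    using g by (intro integrable_scaleR_right) (simp add: std_gauss_integrable_iff)
  then have "integrable lborel (\<lambda>x. (std_normal_density (a + x) * exp (a * (a + x))) *\<^sub>R g (a + x))"
    by (simp only: std_normal_density_shift scaleR_scaleR)
  then have "integrable lborel (\<lambda>x. (std_normal_density x * exp (a * x)) *\<^sub>R g x)"
    using lborel_integrable_real_affine_iff[of 1 "\<lambda>x. (std_normal_density x * exp (a * x)) *\<^sub>R g x" a] by simp
  then show ?thesis by (simp add: std_gauss_integrable_iff)
qed

text \<open>The Cameron-Martin shift: weighting the standard normal law with \<open>exp (a * x)\<close> moves its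
mean to \<open>a\<close>.\<close>
lemma gauss_tilt:
  fixes g :: "real \<Rightarrow> 'a::{banach, second_countable_topology}"
  assumes [measurable]: "g \<in> borel_measurable borel"
  shows "(\<integral>x. exp (a * x) *\<^sub>R g x \<partial>std_gauss) = exp (a\<^sup>2 / 2) *\<^sub>R (\<integral>x. g (a + x) \<partial>std_gauss)"
proof -
  have "(\<integral>x. exp (a * x) *\<^sub>R g x \<partial>std_gauss)
      = (\<integral>x. (std_normal_density x * exp (a * x)) *\<^sub>R g x \<partial>lborel)"
    by (simp add: std_gauss_integral)
  also have "\<dots> = (\<integral>x. (std_normal_density (a + x) * exp (a * (a + x))) *\<^sub>R g (a + x) \<partial>lborel)"
    using lborel_integral_real_affine[of 1 "\<lambda>x. (std_normal_density x * exp (a * x)) *\<^sub>R g x" a] by simp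
  also have "\<dots> = exp (a\<^sup>2 / 2) *\<^sub>R (\<integral>x. g (a + x) \<partial>std_gauss)"
    by (simp add: std_normal_density_shift std_gauss_integral flip: scaleR_scaleR)
  finally show ?thesis .
qed

lemma gauss_tilt_fst:
  fixes g :: "real \<times> real \<Rightarrow> complex"
  assumes meas [measurable]: "g \<in> borel_measurable (borel \<Otimes>\<^sub>M borel)"
    and int: "integrable (std_gauss \<Otimes>\<^sub>M std_gauss) (\<lambda>p. exp (a * fst p) *\<^sub>R g p)"
    and int_shift: "integrable (std_gauss \<Otimes>\<^sub>M std_gauss) (\<lambda>p. g (a + fst p, snd p))"
  shows "(\<integral>p. exp (a * fst p) *\<^sub>R g p \<partial>(std_gauss \<Otimes>\<^sub>M std_gauss))
    = exp (a\<^sup>2 / 2) *\<^sub>R (\<integral>p. g (a + fst p, snd p) \<partial>(std_gauss \<Otimes>\<^sub>M std_gauss))"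
proof -
  have "(\<integral>p. exp (a * fst p) *\<^sub>R g p \<partial>(std_gauss \<Otimes>\<^sub>M std_gauss))
      = (\<integral>y. (\<integral>x. exp (a * x) *\<^sub>R g (x, y) \<partial>std_gauss) \<partial>std_gauss)"
    using std_gauss2.integral_snd[of "\<lambda>x y. exp (a * x) *\<^sub>R g (x, y)"] int by (simp add: case_prod_unfold)
  also have "\<dots> = (\<integral>y. exp (a\<^sup>2 / 2) *\<^sub>R (\<integral>x. g (a + x, y) \<partial>std_gauss) \<partial>std_gauss)"
    by (intro Bochner_Integration.integral_cong refl gauss_tilt) measurable
  also have "\<dots> = exp (a\<^sup>2 / 2) *\<^sub>R (\<integral>y. (\<integral>x. g (a + x, y) \<partial>std_gauss) \<partial>std_gauss)"
    by simp
  also have "(\<integral>y. (\<integral>x. g (a + x, y) \<partial>std_gauss) \<partial>std_gauss) = (\<integral>p. g (a + fst p, snd p) \<partial>(std_gauss \<Otimes>\<^sub>M std_gauss))"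
    using std_gauss2.integral_snd[of "\<lambda>x y. g (a + x, y)"] int_shift by (simp add: case_prod_unfold)
  finally show ?thesis .
qed

lemma std_gauss_reflect:
  fixes f :: "real \<Rightarrow> 'a::{banach, second_countable_topology}"
  assumes [measurable]: "f \<in> borel_measurable borel"
  shows "(\<integral>x. f (- x) \<partial>std_gauss) = (\<integral>x. f x \<partial>std_gauss)"
proof -
  have "std_normal_density (- x) = std_normal_density x" for x by (simp add: std_normal_density_def)
  then show ?thesis
    using lborel_integral_real_affine[of "-1" "\<lambda>x. std_normal_density x *\<^sub>R f x" 0]
    by (simp add: std_gauss_integral)
qed

lemma std_gauss_half_line: "s \<noteq> 0 \<Longrightarrow> (\<integral>x. indicator {x. s * x < 0} x \<partial>std_gauss) = (1 / 2 :: real)"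
proof -
  let ?p = "\<integral>x. indicator {0<..} x \<partial>std_gauss :: real" and ?n = "\<integral>x. indicator {..<0} x \<partial>std_gauss :: real"
  have refl: "?n = ?p"
    using std_gauss_reflect[of "indicator {0<..} :: real \<Rightarrow> real"]
    by (simp add: indicator_def if_distrib cong: if_cong)
  have "?p + ?n = (\<integral>x. indicator {0<..} x + indicator {..<0} x \<partial>std_gauss)"
    by (subst Bochner_Integration.integral_add)
      (auto intro!: std_gauss.integrable_const_bound[where B=1] simp: indicator_def)
  also have "\<dots> = (\<integral>x. 1 \<partial>std_gauss)"
  proof (rule integral_cong_AE)
    have "AE x in lborel. x \<noteq> (0::real)" by (rule AE_lborel_singleton)
    then show "AE x in std_gauss. indicator {0<..} x + indicator {..<0} x = (1::real)"
      by (subst AE_density) (auto simp: indicator_def)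
  qed auto
  finally have "?p + ?n = 1" using std_gauss.prob_space by simp
  moreover assume "s \<noteq> 0"
  then have "{x. s * x < 0} = (if s > 0 then {..<0} else {0<..})"
    by (auto simp: mult_less_0_iff)
  ultimately show ?thesis using refl by simp
qed

lemma std_normal_density_tendsto_0: "(std_normal_density \<longlongrightarrow> 0) at_top"
proof -
  have "filterlim (\<lambda>x::real. (1/2) * x\<^sup>2) at_top at_top"
    by (intro filterlim_tendsto_pos_mult_at_top[OF tendsto_const] filterlim_pow_at_top filterlim_ident) auto
  then have "filterlim (\<lambda>x::real. - ((1/2) * x\<^sup>2)) at_bot at_top"
    by (simp add: filterlim_uminus_at_top)
  then have "((\<lambda>x::real. exp (- ((1/2) * x\<^sup>2))) \<longlongrightarrow> 0) at_top"
    by (rule filterlim_compose[OF exp_at_bot])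
  then have "((\<lambda>x::real. (1 / sqrt (2 * pi)) * exp (- ((1/2) * x\<^sup>2))) \<longlongrightarrow> (1 / sqrt (2 * pi)) * 0) at_top"
    by (intro tendsto_mult tendsto_const)
  then show ?thesis by (simp add: std_normal_density_def[abs_def])
qed

text \<open>Integration by parts: the function \<open>F x = std_normal_density x *\<^sub>R cis (t * x)\<close> has derivative
\<open>(\<i> * t - x) * F x\<close>, and integrating this over the positive half-line gives a gain of
\<open>1 / \<bar>t\<bar>\<close>.\<close>
lemma half_gauss_char_bound:
  assumes t: "t \<noteq> 0"
  shows "cmod (\<integral>x. indicator {0<..} x *\<^sub>R cis (t * x) \<partial>std_gauss)
    \<le> ((\<integral>x. std_normal_density x * \<bar>x\<bar> \<partial>lborel) + std_normal_density 0) / \<bar>t\<bar>"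
proof -
  let ?\<phi> = std_normal_density
  define F where "F x = ?\<phi> x *\<^sub>R cis (t * x)" for x
  define f where "f x = (\<i> * t - x) * F x" for x :: real
  have [measurable]: "F \<in> borel_measurable borel" "f \<in> borel_measurable borel"
    unfolding f_def[abs_def] F_def[abs_def] cis_conv_exp by measurable
  have d\<phi>: "(?\<phi> has_real_derivative - (x * ?\<phi> x)) (at x)" for x
  proof -
    have "((\<lambda>x. K * exp (- x\<^sup>2 / 2)) has_real_derivative - (x * (K * exp (- x\<^sup>2 / 2)))) (at x)" for K
      by (auto intro!: derivative_eq_intros)
    then show ?thesis unfolding std_normal_density_def[abs_def] .
  qed
  have dF: "(F has_vector_derivative f x) (at x)" for x
  proof -
    have "((*) t has_vector_derivative t) (at x)"
      by (auto intro!: derivative_eq_intros simp flip: has_real_derivative_iff_has_vector_derivative)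
    from vector_diff_chain_at[OF this has_vector_derivative_iexp]
    have "((\<lambda>x. cis (t * x)) has_vector_derivative (\<i> * t) * cis (t * x)) (at x)"
      by (simp add: cis_conv_exp comp_def scaleR_conv_of_real mult_ac)
    from has_vector_derivative_scaleR[OF d\<phi> this] show ?thesis
      unfolding F_def[abs_def] f_def by (simp add: scaleR_conv_of_real algebra_simps)
  qed
  have F_int: "integrable lborel F"
    by (rule Bochner_Integration.integrable_bound[OF integrable_normal_density[of 1 0]]) (auto simp: F_def)
  have xF_int: "integrable lborel (\<lambda>x. x * F x)"
    by (rule Bochner_Integration.integrable_bound[OF integrable_std_normal_moment_abs[of 1]])
      (auto simp: F_def norm_mult)
  have f_int: "integrable lborel f"
    unfolding f_def left_diff_distrib using F_int xF_int by simp
  have "(LBINT x=ereal 0..\<infinity>. f x) = 0 - F 0"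
  proof (rule interval_integral_FTC_integrable)
    show "(F has_vector_derivative f x) (at x)" for x by (rule dF)
    show "isCont f x" for x
      unfolding f_def[abs_def] F_def[abs_def] std_normal_density_def cis_conv_exp
      by (intro continuous_intros) auto
    show "set_integrable lborel (einterval (ereal 0) \<infinity>) f"
      using f_int unfolding set_integrable_def by (intro integrable_mult_indicator) auto
    have "isCont F 0" using dF[of 0] has_vector_derivative_continuous by blast
    then show "((F \<circ> real_of_ereal) \<longlongrightarrow> F 0) (at_right (ereal 0))"
      unfolding ereal_tendsto_simps by (simp add: isCont_def filterlim_at_split)
    have "(F \<longlongrightarrow> 0) at_top"
      by (rule tendsto_norm_zero_cancel) (simp add: F_def std_normal_density_tendsto_0)
    then show "((F \<circ> real_of_ereal) \<longlongrightarrow> 0) (at_left \<infinity>)"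
      unfolding ereal_tendsto_simps .
  qed auto
  then have "- F 0 = (\<integral>x. indicator {0<..} x *\<^sub>R f x \<partial>lborel)"
    by (simp add: interval_integral_to_infinity_eq set_lebesgue_integral_def)
  also have "\<dots> = (\<integral>x. (\<i> * t) * (indicator {0<..} x *\<^sub>R F x) - indicator {0<..} x *\<^sub>R (x * F x) \<partial>lborel)"
    by (intro Bochner_Integration.integral_cong refl) (simp add: f_def left_diff_distrib scaleR_diff_right)
  also have "\<dots> = (\<i> * t) * (\<integral>x. indicator {0<..} x *\<^sub>R F x \<partial>lborel) - (\<integral>x. indicator {0<..} x *\<^sub>R (x * F x) \<partial>lborel)"
    using F_int xF_int
    by (subst Bochner_Integration.integral_diff)
      (auto intro!: integrable_mult_indicator integrable_mult_right simp del: mult_scaleR_right)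
  finally have "(\<i> * t) * (\<integral>x. indicator {0<..} x *\<^sub>R F x \<partial>lborel) = (\<integral>x. indicator {0<..} x *\<^sub>R (x * F x) \<partial>lborel) - F 0"
    by (simp add: algebra_simps)
  then have "\<bar>t\<bar> * cmod (\<integral>x. indicator {0<..} x *\<^sub>R F x \<partial>lborel)
      = cmod ((\<integral>x. indicator {0<..} x *\<^sub>R (x * F x) \<partial>lborel) - F 0)"
    by (metis norm_mult norm_ii norm_of_real mult_1)
  also have "\<dots> \<le> cmod (\<integral>x. indicator {0<..} x *\<^sub>R (x * F x) \<partial>lborel) + cmod (F 0)"
    by (rule norm_triangle_ineq4)
  also have "cmod (\<integral>x. indicator {0<..} x *\<^sub>R (x * F x) \<partial>lborel) \<le> (\<integral>x. ?\<phi> x * \<bar>x\<bar> \<partial>lborel)"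
  proof (rule Bochner_Integration.integral_norm_bound_integral)
    show "integrable lborel (\<lambda>x. indicator {0<..} x *\<^sub>R (x * F x))"
      using xF_int by (intro integrable_mult_indicator) auto
    show "integrable lborel (\<lambda>x. ?\<phi> x * \<bar>x\<bar>)" using integrable_std_normal_moment_abs[of 1] by simp
  qed (auto simp: F_def norm_mult indicator_def mult_nonneg_nonpos)
  also have "cmod (F 0) = ?\<phi> 0" by (simp add: F_def)
  also have "(\<integral>x. indicator {0<..} x *\<^sub>R F x \<partial>lborel) = (\<integral>x. indicator {0<..} x *\<^sub>R cis (t * x) \<partial>std_gauss)"
    by (subst std_gauss_integral) (auto simp: F_def cis_conv_exp mult_ac)
  finally show ?thesis using t by (simp add: field_simps)
qed

lemma half_gauss_char_tendsto_0:
  assumes s: "s \<noteq> 0" and t: "filterlim t at_infinity sequentially"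
  shows "(\<lambda>k. \<integral>x. indicator {x. s * x < 0} x *\<^sub>R cis (t k * x) \<partial>std_gauss) \<longlonglongrightarrow> 0"
proof -
  define C where "C = (\<integral>x. std_normal_density x * \<bar>x\<bar> \<partial>lborel) + std_normal_density 0"
  have bound: "cmod (\<integral>x. indicator {x. s * x < 0} x *\<^sub>R cis (u * x) \<partial>std_gauss) \<le> C / \<bar>u\<bar>" if "u \<noteq> 0" for u
  proof (cases "s < 0")
    case True
    then have "{x. s * x < 0} = {0<..}" by (auto simp: mult_less_0_iff)
    then show ?thesis using half_gauss_char_bound[OF that] by (simp add: C_def)
  next
    case False
    then have "{x. s * x < 0} = {..<0}" using s by (auto simp: mult_less_0_iff)
    moreover have "(\<integral>x. indicator {..<0} x *\<^sub>R cis (u * x) \<partial>std_gauss) = (\<integral>x. indicator {0<..} x *\<^sub>R cis (- u * x) \<partial>std_gauss)"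
      using std_gauss_reflect[of "\<lambda>x. indicator {0<..} x *\<^sub>R cis (- u * x)"]
      by (simp add: cis_conv_exp indicator_def if_distrib cong: if_cong)
    ultimately show ?thesis using half_gauss_char_bound[of "-u"] that by (simp add: C_def)
  qed
  have "(\<lambda>k. C * inverse (t k)) \<longlonglongrightarrow> C * 0"
    by (intro tendsto_mult tendsto_const filterlim_compose[OF tendsto_inverse_0 t])
  then have "(\<lambda>k. \<bar>C * inverse (t k)\<bar>) \<longlonglongrightarrow> 0"
    by (simp add: tendsto_rabs_zero_iff)
  moreover have "eventually (\<lambda>k. t k \<noteq> 0) sequentially"
    using filterlim_at_infinity_imp_eventually_ne[OF t] .
  then have "eventually (\<lambda>k. norm (\<integral>x. indicator {x. s * x < 0} x *\<^sub>R cis (t k * x) \<partial>std_gauss) \<le> \<bar>C * inverse (t k)\<bar>) sequentially"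
  proof eventually_elim
    case (elim k)
    have "C / \<bar>t k\<bar> \<le> \<bar>C * inverse (t k)\<bar>" by (simp add: abs_mult divide_inverse mult_right_mono)
    then show ?case using bound[OF elim] by simp
  qed
  ultimately show ?thesis by (rule Lim_null_comparison[rotated])
qed

section \<open>The remainder of the characteristic function on the critical line\<close>

text \<open>The Taylor remainder of \<open>cis (c \<bullet> u)\<close> after the linear term. For a centred random variable its
expectation is the deviation of the characteristic function from 1.\<close>
definition char_remainder :: "complex \<Rightarrow> complex \<Rightarrow> complex" where
  "char_remainder c u = cis (c \<bullet> u) - 1 - \<i> * complex_of_real (c \<bullet> u)"

lemma measurable_char_remainder [measurable]: "char_remainder c \<in> borel_measurable borel"
  unfolding char_remainder_def[abs_def] by measurable

text \<open>The first bound is the useful one for large \<open>u\<close>, the third for small \<open>u\<close>, and the second shows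
that the remainder divided by \<open>(cmod u)\<^sup>2\<close> is bounded, which gives domination.\<close>
lemma char_remainder_bounds:
  "cmod (char_remainder c u) \<le> 2 * (cmod c * cmod u)"
  "cmod (char_remainder c u) \<le> (cmod c * cmod u)\<^sup>2 / 2"
  "cmod (char_remainder c u + complex_of_real ((c \<bullet> u)\<^sup>2 / 2)) \<le> (cmod c * cmod u)^3 / 6"
proof -
  let ?x = "c \<bullet> u"
  have x: "\<bar>?x\<bar> \<le> cmod c * cmod u" by (rule Cauchy_Schwarz_ineq2)
  have H: "char_remainder c u = iexp ?x - (\<Sum>k\<le>1. (\<i> * ?x)^k / fact k)"
    by (simp add: char_remainder_def cis_conv_exp)
  have "cmod (char_remainder c u) \<le> 2 * \<bar>?x\<bar>^1 / fact 1"
    unfolding H by (rule iexp_approx2)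
  then show "cmod (char_remainder c u) \<le> 2 * (cmod c * cmod u)" using x by simp
  have "cmod (char_remainder c u) \<le> \<bar>?x\<bar>^Suc 1 / fact (Suc 1)"
    unfolding H by (rule iexp_approx1)
  also have "\<dots> \<le> (cmod c * cmod u)\<^sup>2 / 2" using power_mono[OF x, of 2] by (simp add: power2_eq_square)
  finally show "cmod (char_remainder c u) \<le> (cmod c * cmod u)\<^sup>2 / 2" .
  have "char_remainder c u + complex_of_real (?x\<^sup>2 / 2) = iexp ?x - (\<Sum>k\<le>2. (\<i> * ?x)^k / fact k)"
  proof -
    have "(\<i> * complex_of_real ?x)\<^sup>2 = - complex_of_real (?x\<^sup>2)" by (simp add: power_mult_distrib)
    then show ?thesis by (simp add: char_remainder_def cis_conv_exp atMost_Suc numeral_2_eq_2)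
  qed
  then have "cmod (char_remainder c u + complex_of_real (?x\<^sup>2 / 2)) \<le> \<bar>?x\<bar>^Suc 2 / fact (Suc 2)"
    using iexp_approx1[of ?x 2] by simp
  also have "\<dots> \<le> (cmod c * cmod u)^3 / 6" using power_mono[OF x, of 3] by (simp add: fact_numeral numeral_3_eq_3)
  finally show "cmod (char_remainder c u + complex_of_real (?x\<^sup>2 / 2)) \<le> (cmod c * cmod u)^3 / 6" .
qed

text \<open>Splits a squared projection into a rotation invariant part and a part that oscillates with twice the
phase.\<close>
lemma inner_scaled_cis_square:
  "(c \<bullet> (a *\<^sub>R cis \<theta>))\<^sup>2 = a\<^sup>2 * ((cmod c)\<^sup>2 + Re ((cnj c)\<^sup>2 * cis (2 * \<theta>))) / 2"
proof -
  have "(Re z)\<^sup>2 = ((cmod z)\<^sup>2 + Re (z\<^sup>2)) / 2" for z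
    unfolding cmod_power2 by (simp add: power2_eq_square)
  moreover have "c \<bullet> cis \<theta> = Re (cnj c * cis \<theta>)" "cmod (cnj c * cis \<theta>) = cmod c"
    by (simp_all add: inner_complex_def norm_mult)
  moreover have "(cnj c * cis \<theta>)\<^sup>2 = (cnj c)\<^sup>2 * cis (2 * \<theta>)"
    by (simp add: power_mult_distrib Complex.DeMoivre)
  ultimately have "(c \<bullet> cis \<theta>)\<^sup>2 = ((cmod c)\<^sup>2 + Re ((cnj c)\<^sup>2 * cis (2 * \<theta>))) / 2"
    by metis
  then show ?thesis by (simp add: power_mult_distrib)
qed

abbreviation gauss2 :: "(real \<times> real) measure" where
  "gauss2 \<equiv> std_gauss \<Otimes>\<^sub>M std_gauss"

lemma sets_gauss2 [measurable_cong]: "sets gauss2 = sets (borel \<Otimes>\<^sub>M borel)"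
  by (intro sets_pair_measure_cong) auto

text \<open>Throughout, a point of \<open>gauss2\<close> is a pair of independent standard normals. The first one is
\<open>X\<close>, and \<open>Y\<close> is the combination called \<open>second\<close> below. The parameter \<open>r\<close> stands for
\<open>sqrt (ln N)\<close>, so that \<open>exp (r\<^sup>2)\<close> is the number \<open>N\<close> of summands.\<close>
locale critical_line =
  fixes \<sigma> \<tau> \<rho> :: real
  assumes \<sigma>: "\<sigma>\<^sup>2 = 1/2" and \<tau>: "\<tau> \<noteq> 0" and \<rho>: "\<bar>\<rho>\<bar> \<le> 1"
begin

definition second :: "real \<times> real \<Rightarrow> real" where
  "second p = \<rho> * fst p + sqrt (1 - \<rho>\<^sup>2) * snd p"

definition weight :: "real \<Rightarrow> real \<times> real \<Rightarrow> complex" where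
  "weight r p = exp (r * (\<sigma> * fst p)) *\<^sub>R cis (r * (\<tau> * second p))"

text \<open>The weight after \<open>X\<close> has been shifted by \<open>2 * r * \<sigma>\<close> and the result divided by \<open>exp (r\<^sup>2)\<close>,
see \<open>weight_shift\<close>. On the line \<open>\<sigma>\<^sup>2 = 1/2\<close> these two operations cancel in the modulus, which
therefore is that of \<open>weight\<close>; only the phase remembers the shift.\<close>
definition tilted_weight :: "real \<Rightarrow> real \<times> real \<Rightarrow> complex" where
  "tilted_weight r p = exp (r * (\<sigma> * fst p)) *\<^sub>R cis (r * (\<tau> * second (2 * r * \<sigma> + fst p, snd p)))"

definition mean_weight :: "real \<Rightarrow> complex" where
  "mean_weight r = exp (r\<^sup>2 * ((1/2 - \<tau>\<^sup>2) / 2)) *\<^sub>R cis (r\<^sup>2 * (\<sigma> * \<tau> * \<rho>))"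

lemma measurable_second [measurable]: "second \<in> borel_measurable (borel \<Otimes>\<^sub>M borel)"
  unfolding second_def[abs_def] by measurable

lemma measurable_weight [measurable]: "weight r \<in> borel_measurable (borel \<Otimes>\<^sub>M borel)"
  unfolding weight_def[abs_def] by measurable

lemma measurable_tilted_weight [measurable]: "tilted_weight r \<in> borel_measurable (borel \<Otimes>\<^sub>M borel)"
  unfolding tilted_weight_def[abs_def] by measurable

lemma \<sigma>_nonzero: "\<sigma> \<noteq> 0" using \<sigma> by auto

lemma norm_tilted_weight: "cmod (tilted_weight r p) = exp (r * (\<sigma> * fst p))"
  by (simp add: tilted_weight_def)

lemma sqrt_square: "(sqrt (1 - \<rho>\<^sup>2))\<^sup>2 = 1 - \<rho>\<^sup>2"
  using \<rho> by (simp add: abs_square_le_1)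

lemma weight_product:
  "weight r p = (exp (r * \<sigma> * fst p) *\<^sub>R cis (r * \<tau> * \<rho> * fst p)) * cis (r * \<tau> * sqrt (1 - \<rho>\<^sup>2) * snd p)"
  by (simp add: weight_def second_def cis_mult algebra_simps)

lemma integrable_weight: "integrable gauss2 (weight r)"
  and integral_weight: "(\<integral>p. weight r p \<partial>gauss2) = mean_weight r"
proof -
  let ?f = "\<lambda>x. exp (r * \<sigma> * x) *\<^sub>R cis (r * \<tau> * \<rho> * x)" and ?g = "\<lambda>y. cis (r * \<tau> * sqrt (1 - \<rho>\<^sup>2) * y)"
  have f: "integrable std_gauss ?f"
    by (intro gauss_tilt_integrable integrable_cis std_gauss.prob_space_axioms) measurable
  have g: "integrable std_gauss ?g"
    by (intro integrable_cis std_gauss.prob_space_axioms) measurable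
  have W: "weight r = (\<lambda>p. ?f (fst p) * ?g (snd p))"
    by (rule ext) (rule weight_product)
  note prod = integrable_product_mult[OF std_gauss.sigma_finite_measure_axioms std_gauss.sigma_finite_measure_axioms f g]
  show "integrable gauss2 (weight r)" unfolding W by (rule prod)
  have "(\<integral>p. weight r p \<partial>gauss2) = (\<integral>x. ?f x \<partial>std_gauss) * (\<integral>y. ?g y \<partial>std_gauss)"
    unfolding W by (rule prod)
  also have "(\<integral>x. ?f x \<partial>std_gauss) = exp ((r * \<sigma>)\<^sup>2 / 2) *\<^sub>R (\<integral>x. cis (r * \<tau> * \<rho> * (r * \<sigma> + x)) \<partial>std_gauss)"
    by (rule gauss_tilt) measurable
  also have "(\<integral>x. cis (r * \<tau> * \<rho> * (r * \<sigma> + x)) \<partial>std_gauss)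
      = (\<integral>x. cis (r\<^sup>2 * (\<sigma> * \<tau> * \<rho>)) * cis (r * \<tau> * \<rho> * x) \<partial>std_gauss)"
    by (simp add: cis_mult power2_eq_square algebra_simps)
  also have "\<dots> = cis (r\<^sup>2 * (\<sigma> * \<tau> * \<rho>)) * exp (- (r * \<tau> * \<rho>)\<^sup>2 / 2)"
    by (simp add: cis_std_gauss)
  also have "(\<integral>y. ?g y \<partial>std_gauss) = exp (- (r * \<tau> * sqrt (1 - \<rho>\<^sup>2))\<^sup>2 / 2)"
    by (rule cis_std_gauss)
  also have "exp ((r * \<sigma>)\<^sup>2 / 2) *\<^sub>R (cis (r\<^sup>2 * (\<sigma> * \<tau> * \<rho>)) * complex_of_real (exp (- (r * \<tau> * \<rho>)\<^sup>2 / 2))) *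
      complex_of_real (exp (- (r * \<tau> * sqrt (1 - \<rho>\<^sup>2))\<^sup>2 / 2))
    = (exp ((r * \<sigma>)\<^sup>2 / 2) * exp (- (r * \<tau> * \<rho>)\<^sup>2 / 2) * exp (- (r * \<tau> * sqrt (1 - \<rho>\<^sup>2))\<^sup>2 / 2)) *\<^sub>R cis (r\<^sup>2 * (\<sigma> * \<tau> * \<rho>))"
    by (simp add: scaleR_conv_of_real mult_ac)
  also have "exp ((r * \<sigma>)\<^sup>2 / 2) * exp (- (r * \<tau> * \<rho>)\<^sup>2 / 2) * exp (- (r * \<tau> * sqrt (1 - \<rho>\<^sup>2))\<^sup>2 / 2)
      = exp (r\<^sup>2 * ((1/2 - \<tau>\<^sup>2) / 2))"
    unfolding exp_add[symmetric] power_mult_distrib sqrt_square \<sigma> by (simp add: field_simps)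
  finally show "(\<integral>p. weight r p \<partial>gauss2) = mean_weight r" unfolding mean_weight_def .
qed

lemma weight_shift: "weight r (2 * r * \<sigma> + fst p, snd p) = exp (r\<^sup>2) *\<^sub>R tilted_weight r p"
proof -
  have "r * (\<sigma> * (2 * r * \<sigma> + fst p)) = r\<^sup>2 * (2 * \<sigma>\<^sup>2) + r * (\<sigma> * fst p)"
    by (simp add: power2_eq_square algebra_simps)
  then show ?thesis by (simp add: weight_def tilted_weight_def \<sigma> exp_add)
qed

lemma tilted_remainder_bound:
  "cmod (exp (- (2 * r * \<sigma>) * fst p) *\<^sub>R char_remainder c (tilted_weight r p)) \<le> (cmod c)\<^sup>2 / 2"
proof -
  have "cmod (exp (- (2 * r * \<sigma>) * fst p) *\<^sub>R char_remainder c (tilted_weight r p))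
      \<le> exp (- (2 * r * \<sigma>) * fst p) * ((cmod c * cmod (tilted_weight r p))\<^sup>2 / 2)"
    using mult_left_mono[OF char_remainder_bounds(2)[of c "tilted_weight r p"], of "exp (- (2 * r * \<sigma>) * fst p)"]
    by simp
  also have "\<dots> = (cmod c)\<^sup>2 / 2 * (exp (- (2 * r * \<sigma>) * fst p) * (exp (r * (\<sigma> * fst p)))\<^sup>2)"
    by (simp add: norm_tilted_weight power_mult_distrib)
  also have "exp (- (2 * r * \<sigma>) * fst p) * (exp (r * (\<sigma> * fst p)))\<^sup>2 = 1"
    by (simp add: power2_eq_square exp_add[symmetric])
  finally show ?thesis by simp
qed

lemma integrable_tilted_remainder:
  "integrable gauss2 (\<lambda>p. exp (- (2 * r * \<sigma>) * fst p) *\<^sub>R char_remainder c (tilted_weight r p))"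
  by (rule std_gauss2.integrable_const_bound[where B="(cmod c)\<^sup>2 / 2"])
    (use tilted_remainder_bound in auto)

lemma integrable_remainder: "integrable gauss2 (\<lambda>p. char_remainder c (weight r p /\<^sub>R exp (r\<^sup>2)))"
proof (rule Bochner_Integration.integrable_bound)
  show "integrable gauss2 (\<lambda>p. (2 * cmod c / exp (r\<^sup>2)) *\<^sub>R weight r p)"
    using integrable_weight by simp
  have "cmod (char_remainder c (weight r p /\<^sub>R exp (r\<^sup>2))) \<le> cmod ((2 * cmod c / exp (r\<^sup>2)) *\<^sub>R weight r p)" for p
    using char_remainder_bounds(1)[of c "weight r p /\<^sub>R exp (r\<^sup>2)"] by (simp add: divide_inverse mult_ac)
  then show "AE p in gauss2. cmod (char_remainder c (weight r p /\<^sub>R exp (r\<^sup>2)))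
      \<le> cmod ((2 * cmod c / exp (r\<^sup>2)) *\<^sub>R weight r p)" by simp
qed measurable

text \<open>The key identity. Writing \<open>U\<close> for \<open>weight r p /\<^sub>R exp (r\<^sup>2)\<close>, the density of the tilted law is
\<open>(cmod U)\<^sup>2\<close> up to a constant, so that \<open>N\<close> times the expectation of the remainder at \<open>U\<close>
becomes the tilted expectation of the bounded function remainder over squared modulus. This
takes the place of truncating the summands.\<close>
lemma remainder_tilt:
  "exp (r\<^sup>2) *\<^sub>R (\<integral>p. char_remainder c (weight r p /\<^sub>R exp (r\<^sup>2)) \<partial>gauss2)
    = (\<integral>p. exp (- (2 * r * \<sigma>) * fst p) *\<^sub>R char_remainder c (tilted_weight r p) \<partial>gauss2)"
proof -
  let ?a = "2 * r * \<sigma>"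
  define g where "g p = exp (- ?a * fst p) *\<^sub>R char_remainder c (weight r p /\<^sub>R exp (r\<^sup>2))" for p
  have a2: "?a\<^sup>2 = 2 * r\<^sup>2" using \<sigma> by (simp add: power_mult_distrib)
  have untilt: "exp (?a * fst p) *\<^sub>R g p = char_remainder c (weight r p /\<^sub>R exp (r\<^sup>2))" for p
    by (simp add: g_def exp_add[symmetric])
  have shift: "g (?a + fst p, snd p)
      = exp (- (2 * r\<^sup>2)) *\<^sub>R (exp (- ?a * fst p) *\<^sub>R char_remainder c (tilted_weight r p))" for p
  proof -
    have "exp (- ?a * (?a + fst p)) = exp (- (2 * r\<^sup>2)) * exp (- ?a * fst p)"
      unfolding exp_add[symmetric] using a2 by (simp add: power2_eq_square algebra_simps)
    then show ?thesis by (simp add: g_def weight_shift)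
  qed
  have "(\<integral>p. exp (?a * fst p) *\<^sub>R g p \<partial>gauss2) = exp (?a\<^sup>2 / 2) *\<^sub>R (\<integral>p. g (?a + fst p, snd p) \<partial>gauss2)"
  proof (rule gauss_tilt_fst)
    show "g \<in> borel_measurable (borel \<Otimes>\<^sub>M borel)" unfolding g_def[abs_def] by measurable
    show "integrable gauss2 (\<lambda>p. exp (?a * fst p) *\<^sub>R g p)"
      unfolding untilt by (rule integrable_remainder)
    show "integrable gauss2 (\<lambda>p. g (?a + fst p, snd p))"
      unfolding shift by (intro integrable_scaleR_right integrable_tilted_remainder)
  qed
  then have "(\<integral>p. char_remainder c (weight r p /\<^sub>R exp (r\<^sup>2)) \<partial>gauss2)
      = (exp (r\<^sup>2) * exp (- (2 * r\<^sup>2))) *\<^sub>R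
        (\<integral>p. exp (- ?a * fst p) *\<^sub>R char_remainder c (tilted_weight r p) \<partial>gauss2)"
    unfolding untilt shift a2 integral_scaleR_right by simp
  moreover have "exp (r\<^sup>2) * (exp (r\<^sup>2) * exp (- (2 * r\<^sup>2))) = 1"
    unfolding exp_add[symmetric] by simp
  ultimately show ?thesis by simp
qed

text \<open>What is left of the tilted integrand for large \<open>r\<close>. Where \<open>\<sigma> * fst p > 0\<close> the tilted weight
grows and the quotient tends to 0; where \<open>\<sigma> * fst p < 0\<close> the weight is small and the quotient
is given by the quadratic term of the Taylor expansion.\<close>
definition limit_remainder :: "complex \<Rightarrow> real \<Rightarrow> real \<times> real \<Rightarrow> real" where
  "limit_remainder c r p = - (indicator {x. \<sigma> * x < 0} (fst p) *
     (((cmod c)\<^sup>2 + Re ((cnj c)\<^sup>2 * cis (2 * (r * (\<tau> * second (2 * r * \<sigma> + fst p, snd p)))))) / 4))"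

lemma measurable_limit_remainder [measurable]: "limit_remainder c r \<in> borel_measurable (borel \<Otimes>\<^sub>M borel)"
  unfolding limit_remainder_def[abs_def] by measurable

lemma limit_remainder_bound: "\<bar>limit_remainder c r p\<bar> \<le> (cmod c)\<^sup>2 / 2"
proof -
  have "\<bar>Re ((cnj c)\<^sup>2 * cis \<theta>)\<bar> \<le> (cmod c)\<^sup>2" for \<theta>
    using abs_Re_le_cmod[of "(cnj c)\<^sup>2 * cis \<theta>"] by (simp add: norm_mult norm_power)
  from this[of "2 * (r * (\<tau> * second (2 * r * \<sigma> + fst p, snd p)))"] show ?thesis
    by (auto simp: limit_remainder_def indicator_def)
qed

lemma remainder_close_to_limit:
  assumes "\<sigma> * fst p \<noteq> 0" and r: "filterlim r at_top sequentially"
  shows "(\<lambda>k. exp (- (2 * r k * \<sigma>) * fst p) *\<^sub>R char_remainder c (tilted_weight (r k) p)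
           - complex_of_real (limit_remainder c (r k) p)) \<longlonglongrightarrow> 0"
proof -
  define u where "u = \<sigma> * fst p"
  have scale: "exp (- (2 * s * \<sigma>) * fst p) = exp (- (2 * (s * u)))" for s
    by (simp add: u_def mult_ac)
  have norm: "cmod (tilted_weight s p) = exp (s * u)" for s
    by (simp add: norm_tilted_weight u_def)
  have decay: "(\<lambda>k. K * exp (- (r k * v))) \<longlonglongrightarrow> 0" if "0 < v" for K v
  proof -
    have "filterlim (\<lambda>k. v * r k) at_top sequentially"
      by (rule filterlim_tendsto_pos_mult_at_top[OF tendsto_const that r])
    then have "filterlim (\<lambda>k. - (r k * v)) at_bot sequentially"
      by (simp add: filterlim_uminus_at_top mult.commute)
    from tendsto_mult[OF tendsto_const filterlim_compose[OF exp_at_bot this], of K] show ?thesis by simp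
  qed
  have "u \<noteq> 0" using assms by (simp add: u_def)
  then consider "0 < u" | "u < 0" by linarith
  then show ?thesis
  proof cases
    case 1
    have "norm (exp (- (2 * s * \<sigma>) * fst p) *\<^sub>R char_remainder c (tilted_weight s p)
        - complex_of_real (limit_remainder c s p)) \<le> (2 * cmod c) * exp (- (s * u))" for s
    proof -
      have "limit_remainder c s p = 0" using 1 by (simp add: limit_remainder_def u_def indicator_def)
      then have "norm (exp (- (2 * s * \<sigma>) * fst p) *\<^sub>R char_remainder c (tilted_weight s p)
          - complex_of_real (limit_remainder c s p)) = exp (- (2 * (s * u))) * cmod (char_remainder c (tilted_weight s p))"
        unfolding scale by simp
      also have "\<dots> \<le> exp (- (2 * (s * u))) * (2 * (cmod c * exp (s * u)))"
        using char_remainder_bounds(1)[of c "tilted_weight s p"] by (simp add: norm)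
      also have "\<dots> = (2 * cmod c) * (exp (- (2 * (s * u))) * exp (s * u))" by simp
      also have "exp (- (2 * (s * u))) * exp (s * u) = exp (- (s * u))"
        unfolding exp_add[symmetric] by simp
      finally show ?thesis .
    qed
    then show ?thesis by (intro Lim_null_comparison[OF always_eventually decay[OF 1, of "2 * cmod c"]]) auto
  next
    case 2
    have "norm (exp (- (2 * s * \<sigma>) * fst p) *\<^sub>R char_remainder c (tilted_weight s p)
        - complex_of_real (limit_remainder c s p)) \<le> ((cmod c)^3 / 6) * exp (- (s * (- u)))" for s
    proof -
      let ?\<theta> = "s * (\<tau> * second (2 * s * \<sigma> + fst p, snd p))"
      define q where "q = (cmod c)\<^sup>2 + Re ((cnj c)\<^sup>2 * cis (2 * ?\<theta>))"
      have e2: "exp (- (2 * (s * u))) * (exp (s * u))\<^sup>2 = 1"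
        by (simp add: power2_eq_square exp_add[symmetric])
      have "(c \<bullet> tilted_weight s p)\<^sup>2 = (exp (s * u))\<^sup>2 * q / 2"
        unfolding tilted_weight_def inner_scaled_cis_square q_def by (simp add: u_def)
      then have "exp (- (2 * (s * u))) * ((c \<bullet> tilted_weight s p)\<^sup>2 / 2)
          = (exp (- (2 * (s * u))) * (exp (s * u))\<^sup>2) * q / 4"
        by simp
      also have "\<dots> = - limit_remainder c s p"
        unfolding e2 using 2 by (simp add: limit_remainder_def u_def[symmetric] q_def)
      finally have main: "exp (- (2 * (s * u))) * ((c \<bullet> tilted_weight s p)\<^sup>2 / 2) = - limit_remainder c s p" .
      have "exp (- (2 * s * \<sigma>) * fst p) *\<^sub>R char_remainder c (tilted_weight s p)
          - complex_of_real (limit_remainder c s p)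
          = exp (- (2 * (s * u))) *\<^sub>R (char_remainder c (tilted_weight s p) + complex_of_real ((c \<bullet> tilted_weight s p)\<^sup>2 / 2))"
      proof -
        have "exp (- (2 * (s * u))) *\<^sub>R complex_of_real ((c \<bullet> tilted_weight s p)\<^sup>2 / 2)
            = - complex_of_real (limit_remainder c s p)"
          using arg_cong[OF main, of complex_of_real] by (simp only: scaleR_conv_of_real of_real_mult of_real_minus)
        then show ?thesis unfolding scale scaleR_add_right by simp
      qed
      also have "norm \<dots> \<le> exp (- (2 * (s * u))) * ((cmod c * exp (s * u))^3 / 6)"
        using char_remainder_bounds(3)[of c "tilted_weight s p"] by (simp add: norm)
      also have "\<dots> = ((cmod c)^3 / 6) * (exp (- (2 * (s * u))) * (exp (s * u))\<^sup>2) * exp (- (s * (- u)))"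
        by (simp add: power_mult_distrib power3_eq_cube power2_eq_square)
      finally show ?thesis unfolding e2 by simp
    qed
    then show ?thesis using 2
      by (intro Lim_null_comparison[OF always_eventually decay[of "-u" "(cmod c)^3 / 6"]]) auto
  qed
qed

text \<open>The integral factors into the transform of a half Gaussian at \<open>2 * r * \<tau> * \<rho>\<close> and the transform of a
full Gaussian at \<open>2 * r * \<tau> * sqrt (1 - \<rho>\<^sup>2)\<close>. Both are bounded by 1. The second one decays unless
\<open>\<bar>\<rho>\<bar> = 1\<close>, and in that case the first one does. For \<open>\<tau> = 0\<close> neither would decay.\<close>
lemma oscillation_vanishes:
  assumes r: "filterlim r at_top sequentially"
  shows "(\<lambda>k. \<integral>p. indicator {x. \<sigma> * x < 0} (fst p) *\<^sub>R
      cis (2 * (r k * (\<tau> * second (2 * r k * \<sigma> + fst p, snd p)))) \<partial>gauss2) \<longlonglongrightarrow> 0"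
proof -
  let ?A = "\<lambda>t. \<integral>x. indicator {x. \<sigma> * x < 0} x *\<^sub>R cis (t * x) \<partial>std_gauss"
  have A_meas [measurable]: "(\<lambda>x. indicator {x. \<sigma> * x < 0} x *\<^sub>R cis (t * x)) \<in> borel_measurable borel" for t
    by measurable
  have A_int: "integrable std_gauss (\<lambda>x. indicator {x. \<sigma> * x < 0} x *\<^sub>R cis (t * x))" for t
    by (rule std_gauss.integrable_const_bound[where B=1]) (auto simp: indicator_def)
  have A_le: "cmod (?A t) \<le> 1" for t
  proof -
    have "cmod (?A t) \<le> (\<integral>x. 1 \<partial>std_gauss)"
      by (rule Bochner_Integration.integral_norm_bound_integral[OF A_int]) (auto simp: indicator_def)
    then show ?thesis using std_gauss.prob_space by simp
  qed
  have norm: "cmod (\<integral>p. indicator {x. \<sigma> * x < 0} (fst p) *\<^sub>R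
      cis (2 * (s * (\<tau> * second (2 * s * \<sigma> + fst p, snd p)))) \<partial>gauss2)
      = cmod (?A (2 * s * \<tau> * \<rho>)) * exp (- (2 * s * \<tau> * sqrt (1 - \<rho>\<^sup>2))\<^sup>2 / 2)" for s
  proof -
    have "(\<integral>p. indicator {x. \<sigma> * x < 0} (fst p) *\<^sub>R cis (2 * (s * (\<tau> * second (2 * s * \<sigma> + fst p, snd p)))) \<partial>gauss2)
       = (\<integral>p. cis (4 * s\<^sup>2 * \<tau> * \<rho> * \<sigma>) * ((indicator {x. \<sigma> * x < 0} (fst p) *\<^sub>R cis (2 * s * \<tau> * \<rho> * fst p))
           * cis (2 * s * \<tau> * sqrt (1 - \<rho>\<^sup>2) * snd p)) \<partial>gauss2)"
      by (intro Bochner_Integration.integral_cong refl)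
        (simp add: indicator_def second_def cis_mult power2_eq_square algebra_simps)
    also have "\<dots> = cis (4 * s\<^sup>2 * \<tau> * \<rho> * \<sigma>) * (?A (2 * s * \<tau> * \<rho>)
        * (\<integral>y. cis (2 * s * \<tau> * sqrt (1 - \<rho>\<^sup>2) * y) \<partial>std_gauss))"
      unfolding integral_mult_right_zero
      by (subst integrable_product_mult(2)[OF std_gauss.sigma_finite_measure_axioms std_gauss.sigma_finite_measure_axioms A_int
          integrable_cis[OF std_gauss.prob_space_axioms]]) auto
    finally show ?thesis unfolding cis_std_gauss by (simp add: norm_mult)
  qed
  have "(\<lambda>k. cmod (?A (2 * r k * \<tau> * \<rho>)) * exp (- (2 * r k * \<tau> * sqrt (1 - \<rho>\<^sup>2))\<^sup>2 / 2)) \<longlonglongrightarrow> 0"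
  proof (cases "\<bar>\<rho>\<bar> = 1")
    case True
    then have "\<rho>\<^sup>2 = 1" by (metis power2_abs one_power2)
    moreover have "filterlim (\<lambda>k. 2 * r k * \<tau> * \<rho>) at_infinity sequentially"
    proof -
      have "2 * \<tau> * \<rho> \<noteq> 0" using True \<tau> by auto
      from tendsto_mult_filterlim_at_infinity[OF tendsto_const this filterlim_mono[OF r at_top_le_at_infinity order_refl]]
      show ?thesis by (simp add: mult_ac)
    qed
    from half_gauss_char_tendsto_0[OF \<sigma>_nonzero this] have "(\<lambda>k. ?A (2 * r k * \<tau> * \<rho>)) \<longlonglongrightarrow> 0" .
    ultimately show ?thesis by (simp add: tendsto_norm_zero)
  next
    case False
    then have "\<rho>\<^sup>2 < 1" using \<rho> by (simp add: abs_square_less_1)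
    define v where "v = 2 * \<tau>\<^sup>2 * (1 - \<rho>\<^sup>2)"
    have "0 < v" using \<open>\<rho>\<^sup>2 < 1\<close> \<tau> by (simp add: v_def)
    have e: "- (2 * s * \<tau> * sqrt (1 - \<rho>\<^sup>2))\<^sup>2 / 2 = - (v * s\<^sup>2)" for s
      unfolding power_mult_distrib sqrt_square v_def by simp
    have "filterlim (\<lambda>k. v * (r k)\<^sup>2) at_top sequentially"
      by (intro filterlim_tendsto_pos_mult_at_top[OF tendsto_const \<open>0 < v\<close>] filterlim_pow_at_top r) simp
    then have "filterlim (\<lambda>k. - (v * (r k)\<^sup>2)) at_bot sequentially"
      by (simp add: filterlim_uminus_at_top)
    then have lim: "(\<lambda>k. exp (- (v * (r k)\<^sup>2))) \<longlonglongrightarrow> 0"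
      by (rule filterlim_compose[OF exp_at_bot])
    show ?thesis unfolding e
      by (rule Lim_null_comparison[OF always_eventually lim])
        (auto intro!: mult_left_le_one_le A_le simp: norm_mult)
  qed
  then show ?thesis unfolding norm[symmetric] by (rule tendsto_norm_zero_cancel)
qed

text \<open>The half-line has Gaussian mass 1/2 and the oscillating part disappears. Hence the total variance of
the limit is 1/2, although the normalised summands have total second moment 1.\<close>
lemma limit_remainder_integral_tendsto:
  assumes r: "filterlim r at_top sequentially"
  shows "(\<lambda>k. \<integral>p. limit_remainder c (r k) p \<partial>gauss2) \<longlonglongrightarrow> - (cmod c)\<^sup>2 / 8"
proof -
  let ?I = "\<lambda>p::real \<times> real. indicator {x. \<sigma> * x < 0} (fst p) :: real"
  let ?e = "\<lambda>s p. cis (2 * (s * (\<tau> * second (2 * s * \<sigma> + fst p, snd p))))"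
  have I_int: "integrable gauss2 ?I"
    by (rule std_gauss2.integrable_const_bound[where B=1]) (auto simp: indicator_def)
  have e_int: "integrable gauss2 (\<lambda>p. ?I p *\<^sub>R ?e s p)" for s
    by (rule std_gauss2.integrable_const_bound[where B=1]) (auto simp: indicator_def)
  have half: "(\<integral>p. ?I p \<partial>gauss2) = 1/2"
    using std_gauss2.integral_fst'[OF I_int] std_gauss_half_line[OF \<sigma>_nonzero] std_gauss.prob_space by simp
  have "(\<integral>p. limit_remainder c s p \<partial>gauss2)
      = - (cmod c)\<^sup>2 / 8 - Re ((cnj c)\<^sup>2 * (\<integral>p. ?I p *\<^sub>R ?e s p \<partial>gauss2)) / 4" for s
  proof -
    have "(\<integral>p. limit_remainder c s p \<partial>gauss2)
       = (\<integral>p. - ((cmod c)\<^sup>2 / 4) * ?I p - Re ((cnj c)\<^sup>2 * (?I p *\<^sub>R ?e s p)) / 4 \<partial>gauss2)"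
      by (intro Bochner_Integration.integral_cong refl) (simp add: limit_remainder_def indicator_def field_simps)
    also have "\<dots> = - ((cmod c)\<^sup>2 / 4) * (\<integral>p. ?I p \<partial>gauss2) - Re (\<integral>p. (cnj c)\<^sup>2 * (?I p *\<^sub>R ?e s p) \<partial>gauss2) / 4"
    proof (subst Bochner_Integration.integral_diff)
      have int: "integrable gauss2 (\<lambda>p. (cnj c)\<^sup>2 * (?I p *\<^sub>R ?e s p))"
        by (intro integrable_mult_right e_int)
      show "integrable gauss2 (\<lambda>p. - ((cmod c)\<^sup>2 / 4) * ?I p)" by (intro integrable_mult_right I_int)
      show "integrable gauss2 (\<lambda>p. Re ((cnj c)\<^sup>2 * (?I p *\<^sub>R ?e s p)) / 4)"
        by (intro integrable_divide integrable_Re int)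
    qed (simp only: integral_mult_right_zero integral_divide_zero integral_Re[OF integrable_mult_right[OF e_int]])
    also have "(\<integral>p. (cnj c)\<^sup>2 * (?I p *\<^sub>R ?e s p) \<partial>gauss2) = (cnj c)\<^sup>2 * (\<integral>p. ?I p *\<^sub>R ?e s p \<partial>gauss2)"
      by (rule integral_mult_right_zero)
    finally show ?thesis unfolding half by simp
  qed
  moreover have "(\<lambda>k. - (cmod c)\<^sup>2 / 8 - Re ((cnj c)\<^sup>2 * (\<integral>p. ?I p *\<^sub>R ?e (r k) p \<partial>gauss2)) / 4)
      \<longlonglongrightarrow> - (cmod c)\<^sup>2 / 8 - Re ((cnj c)\<^sup>2 * 0) / 4"
    by (intro tendsto_intros oscillation_vanishes r) simp
  ultimately show ?thesis by simp
qed

lemma remainder_integral_tendsto: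
  assumes r: "filterlim r at_top sequentially"
  shows "(\<lambda>k. exp ((r k)\<^sup>2) *\<^sub>R (\<integral>p. char_remainder c (weight (r k) p /\<^sub>R exp ((r k)\<^sup>2)) \<partial>gauss2))
    \<longlonglongrightarrow> complex_of_real (- (cmod c)\<^sup>2 / 8)"
proof -
  let ?T = "\<lambda>s p. exp (- (2 * s * \<sigma>) * fst p) *\<^sub>R char_remainder c (tilted_weight s p)"
  let ?L = "\<lambda>s p. complex_of_real (limit_remainder c s p)"
  have L_int: "integrable gauss2 (limit_remainder c s)" for s
    by (rule std_gauss2.integrable_const_bound[where B="(cmod c)\<^sup>2 / 2"]) (use limit_remainder_bound in auto)
  have nonzero: "AE p in gauss2. \<sigma> * fst p \<noteq> 0"
  proof -
    have "AE x in lborel. x \<noteq> (0::real)" by (rule AE_lborel_singleton)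
    then have "AE x in std_gauss. \<sigma> * x \<noteq> 0"
      using \<sigma>_nonzero by (subst AE_density) auto
    then show ?thesis
    proof (intro std_gauss2.AE_pair_measure)
      have "(\<lambda>p. \<sigma> * fst p) -` (- {0}) \<inter> space gauss2 \<in> sets gauss2"
        by (rule measurable_sets[where A=borel]) auto
      also have "(\<lambda>p. \<sigma> * fst p) -` (- {0}) \<inter> space gauss2 = {p \<in> space gauss2. \<sigma> * fst p \<noteq> 0}"
        by auto
      finally show "{p \<in> space gauss2. \<sigma> * fst p \<noteq> 0} \<in> sets gauss2" .
    qed simp
  qed
  have "(\<lambda>k. \<integral>p. ?T (r k) p - ?L (r k) p \<partial>gauss2) \<longlonglongrightarrow> (\<integral>p. 0 \<partial>gauss2)"
  proof (rule integral_dominated_convergence[where w="\<lambda>_. (cmod c)\<^sup>2 / 2 + (cmod c)\<^sup>2 / 2"])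
    show "AE p in gauss2. (\<lambda>k. ?T (r k) p - ?L (r k) p) \<longlonglongrightarrow> 0"
      using nonzero by eventually_elim (rule remainder_close_to_limit[OF _ r])
    show "AE p in gauss2. cmod (?T (r k) p - ?L (r k) p) \<le> (cmod c)\<^sup>2 / 2 + (cmod c)\<^sup>2 / 2" for k
    proof (intro always_eventually allI)
      fix p
      show "cmod (?T (r k) p - ?L (r k) p) \<le> (cmod c)\<^sup>2 / 2 + (cmod c)\<^sup>2 / 2"
        by (rule order_trans[OF norm_triangle_ineq4 add_mono[OF tilted_remainder_bound]])
          (use limit_remainder_bound[of c "r k" p] in simp)
    qed
  qed (auto simp del: scaleR_minus_left)
  then have "(\<lambda>k. (\<integral>p. ?T (r k) p \<partial>gauss2) - complex_of_real (\<integral>p. limit_remainder c (r k) p \<partial>gauss2)) \<longlonglongrightarrow> 0"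
    using integrable_tilted_remainder L_int by (simp add: Bochner_Integration.integral_diff)
  from tendsto_add[OF this tendsto_of_real[OF limit_remainder_integral_tendsto[OF r, of c]]]
  show ?thesis unfolding remainder_tilt by simp
qed

end

section \<open>Passage to the limit\<close>

text \<open>A telescoping comparison with \<open>(1 - a / n) ^ n\<close>, valid because all bases lie in the unit disc.\<close>
lemma power_tendsto_exp:
  fixes z :: "nat \<Rightarrow> complex"
  assumes z: "\<And>n. cmod (z n) \<le> 1" and a: "0 \<le> a"
    and lim: "(\<lambda>n. real n *\<^sub>R (z n - 1)) \<longlonglongrightarrow> complex_of_real (- a)"
  shows "(\<lambda>n. z n ^ n) \<longlonglongrightarrow> complex_of_real (exp (- a))"
proof -
  define w where "w n = 1 + (- a) / real n" for n
  have "(\<lambda>n. cmod (real n *\<^sub>R (z n - 1) - complex_of_real (- a))) \<longlonglongrightarrow> 0"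
    by (rule tendsto_norm_zero[OF LIM_zero[OF lim]])
  moreover have "eventually (\<lambda>n. norm (z n ^ n - complex_of_real (w n) ^ n) \<le> cmod (real n *\<^sub>R (z n - 1) - complex_of_real (- a))) sequentially"
    using eventually_ge_at_top[of "nat \<lceil>a\<rceil> + 1"]
  proof eventually_elim
    case (elim n)
    then have n: "1 \<le> real n" "a \<le> real n" by linarith+
    then have w01: "0 \<le> w n" "w n \<le> 1" using a by (auto simp: w_def field_simps)
    have "norm (z n ^ n - complex_of_real (w n) ^ n) \<le> real n * norm (z n - complex_of_real (w n))"
      using w01 by (intro norm_power_diff z) simp
    also have "\<dots> = norm (real n *\<^sub>R (z n - complex_of_real (w n)))" by simp
    also have "real n *\<^sub>R (z n - complex_of_real (w n)) = real n *\<^sub>R (z n - 1) - complex_of_real (- a)"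
      using n by (simp add: w_def scaleR_conv_of_real field_simps)
    finally show ?case .
  qed
  ultimately have "(\<lambda>n. z n ^ n - complex_of_real (w n) ^ n) \<longlonglongrightarrow> 0"
    by (rule Lim_null_comparison[rotated])
  moreover have "(\<lambda>n. complex_of_real (w n) ^ n) \<longlonglongrightarrow> complex_of_real (exp (- a))"
    using tendsto_of_real[OF tendsto_exp_limit_sequentially[of "- a"], where 'a=complex] by (simp add: w_def)
  ultimately have "(\<lambda>n. (z n ^ n - complex_of_real (w n) ^ n) + complex_of_real (w n) ^ n) \<longlonglongrightarrow> 0 + complex_of_real (exp (- a))"
    by (rule tendsto_add)
  then show ?thesis by simp
qed

context critical_line begin

definition centred_char :: "complex \<Rightarrow> real \<Rightarrow> complex" where
  "centred_char c r = (\<integral>p. cis (c \<bullet> ((weight r p - mean_weight r) /\<^sub>R exp (r\<^sup>2))) \<partial>gauss2)"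

lemma norm_centred_char: "cmod (centred_char c r) \<le> 1"
proof -
  have "cmod (centred_char c r) \<le> (\<integral>p. 1 \<partial>gauss2)"
    unfolding centred_char_def
    by (intro Bochner_Integration.integral_norm_bound_integral integrable_cis std_gauss2.prob_space_axioms) auto
  then show ?thesis using std_gauss2.prob_space by simp
qed

text \<open>Removing the mean only multiplies by a phase, so the remainder estimate for the uncentred weight
carries over.\<close>
lemma centred_char_expansion:
  fixes c r defines "\<delta> \<equiv> c \<bullet> (mean_weight r /\<^sub>R exp (r\<^sup>2))"
  shows "centred_char c r = cis (- \<delta>) *
    (1 + \<i> * complex_of_real \<delta> + (\<integral>p. char_remainder c (weight r p /\<^sub>R exp (r\<^sup>2)) \<partial>gauss2))"
proof -
  let ?U = "\<lambda>p. weight r p /\<^sub>R exp (r\<^sup>2)"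
  have U_int: "integrable gauss2 ?U" using integrable_weight by simp
  have cU_int: "integrable gauss2 (\<lambda>p. \<i> * complex_of_real (c \<bullet> ?U p))"
    by (intro integrable_mult_right integrable_of_real integrable_inner_right U_int)
  have mean: "(\<integral>p. c \<bullet> ?U p \<partial>gauss2) = \<delta>"
    using integral_inner_right[OF U_int, of c] by (simp add: \<delta>_def integral_weight)
  have "centred_char c r = (\<integral>p. cis (- \<delta>) * (1 + \<i> * complex_of_real (c \<bullet> ?U p) + char_remainder c (?U p)) \<partial>gauss2)"
    unfolding centred_char_def
    by (intro Bochner_Integration.integral_cong refl)
      (simp add: char_remainder_def cis_mult \<delta>_def inner_diff_right scaleR_diff_right del: inner_scaleR_right)
  also have "\<dots> = cis (- \<delta>) * (\<integral>p. 1 + \<i> * complex_of_real (c \<bullet> ?U p) + char_remainder c (?U p) \<partial>gauss2)"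
    by (rule integral_mult_right_zero)
  also have "(\<integral>p. 1 + \<i> * complex_of_real (c \<bullet> ?U p) + char_remainder c (?U p) \<partial>gauss2)
     = (\<integral>p. 1 \<partial>gauss2) + (\<integral>p. \<i> * complex_of_real (c \<bullet> ?U p) \<partial>gauss2) + (\<integral>p. char_remainder c (?U p) \<partial>gauss2)"
    by (simp only: Bochner_Integration.integral_add[OF Bochner_Integration.integrable_add[OF std_gauss2.integrable_const cU_int] integrable_remainder]
      Bochner_Integration.integral_add[OF std_gauss2.integrable_const cU_int])
  also have "(\<integral>p. \<i> * complex_of_real (c \<bullet> ?U p) \<partial>gauss2) = \<i> * complex_of_real \<delta>"
    by (simp only: integral_mult_right_zero integral_complex_of_real mean)
  also have "(\<integral>p. 1 \<partial>gauss2) = (1 :: complex)"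
    using std_gauss2.prob_space by simp
  finally show ?thesis .
qed

text \<open>The centring costs \<open>N * \<delta>\<^sup>2\<close>, and \<open>\<bar>\<delta>\<bar>\<close> is at most \<open>cmod c\<close> times the modulus of the mean of
a normalised summand. That modulus is \<open>N powr (- 3/4 - \<tau>\<^sup>2 / 2)\<close>, so the cost is of order
\<open>N powr (- 1/2 - \<tau>\<^sup>2)\<close>.\<close>
lemma centred_char_asymptotics:
  assumes r: "filterlim r at_top sequentially"
  shows "(\<lambda>k. exp ((r k)\<^sup>2) *\<^sub>R (centred_char c (r k) - 1)) \<longlonglongrightarrow> complex_of_real (- ((cmod c)\<^sup>2 / 8))"
proof -
  define \<delta> where "\<delta> k = c \<bullet> (mean_weight (r k) /\<^sub>R exp ((r k)\<^sup>2))" for k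
  define h where "h k = (\<integral>p. char_remainder c (weight (r k) p /\<^sub>R exp ((r k)\<^sup>2)) \<partial>gauss2)" for k
  \<comment> \<open>In terms of \<open>N = exp ((r k)\<^sup>2)\<close> this is \<open>(cmod c)\<^sup>2 * N powr (- 1/2 - \<tau>\<^sup>2)\<close>.\<close>
  define b where "b k = (cmod c)\<^sup>2 * exp (- ((1/2 + \<tau>\<^sup>2) * (r k)\<^sup>2))" for k
  have b_lim: "b \<longlonglongrightarrow> 0"
  proof -
    have "0 < 1/2 + \<tau>\<^sup>2" by (simp add: add_pos_nonneg)
    then have "filterlim (\<lambda>k. (1/2 + \<tau>\<^sup>2) * (r k)\<^sup>2) at_top sequentially"
      by (intro filterlim_tendsto_pos_mult_at_top[OF tendsto_const] filterlim_pow_at_top r) auto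
    then have "filterlim (\<lambda>k. - ((1/2 + \<tau>\<^sup>2) * (r k)\<^sup>2)) at_bot sequentially"
      by (simp add: filterlim_uminus_at_top)
    from tendsto_mult[OF tendsto_const filterlim_compose[OF exp_at_bot this], of "(cmod c)\<^sup>2"]
    show ?thesis by (simp add: b_def[abs_def])
  qed
  have \<delta>2: "exp ((r k)\<^sup>2) * (\<delta> k)\<^sup>2 \<le> b k" for k
  proof -
    have "\<bar>\<delta> k\<bar> \<le> cmod c * cmod (mean_weight (r k) /\<^sub>R exp ((r k)\<^sup>2))"
      unfolding \<delta>_def by (rule Cauchy_Schwarz_ineq2)
    also have "cmod (mean_weight (r k) /\<^sub>R exp ((r k)\<^sup>2)) = exp ((r k)\<^sup>2 * ((1/2 - \<tau>\<^sup>2) / 2) - (r k)\<^sup>2)"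
      unfolding mean_weight_def exp_diff norm_scaleR norm_cis by (simp only: abs_exp_cancel abs_inverse) (simp add: field_simps)
    finally have "(\<delta> k)\<^sup>2 \<le> (cmod c * exp ((r k)\<^sup>2 * ((1/2 - \<tau>\<^sup>2) / 2) - (r k)\<^sup>2))\<^sup>2"
      using power_mono[of "\<bar>\<delta> k\<bar>" _ 2] by simp
    then have "exp ((r k)\<^sup>2) * (\<delta> k)\<^sup>2
        \<le> exp ((r k)\<^sup>2) * (cmod c * exp ((r k)\<^sup>2 * ((1/2 - \<tau>\<^sup>2) / 2) - (r k)\<^sup>2))\<^sup>2"
      by (intro mult_left_mono) auto
    also have "\<dots> = (cmod c)\<^sup>2 * (exp ((r k)\<^sup>2) * (exp ((r k)\<^sup>2 * ((1/2 - \<tau>\<^sup>2) / 2) - (r k)\<^sup>2))\<^sup>2)"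
      by (simp add: power_mult_distrib)
    also have "exp ((r k)\<^sup>2) * (exp ((r k)\<^sup>2 * ((1/2 - \<tau>\<^sup>2) / 2) - (r k)\<^sup>2))\<^sup>2 = exp (- ((1/2 + \<tau>\<^sup>2) * (r k)\<^sup>2))"
    proof -
      have "R + ((R * ((1/2 - t) / 2) - R) + (R * ((1/2 - t) / 2) - R)) = - ((1/2 + t) * R)" for R t :: real
        by (simp add: field_simps)
      then show ?thesis unfolding power2_eq_square[of "exp (_ - _)"] exp_add[symmetric]
        by (rule arg_cong)
    qed
    finally show ?thesis unfolding b_def .
  qed
  have \<delta>_lim: "\<delta> \<longlonglongrightarrow> 0"
  proof -
    have "(\<delta> k)\<^sup>2 \<le> b k" for k
    proof -
      have "1 * (\<delta> k)\<^sup>2 \<le> exp ((r k)\<^sup>2) * (\<delta> k)\<^sup>2" by (intro mult_right_mono) auto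
      then show ?thesis using \<delta>2[of k] by linarith
    qed
    then have "(\<lambda>k. (\<delta> k)\<^sup>2) \<longlonglongrightarrow> 0"
      by (intro Lim_null_comparison[OF always_eventually b_lim]) simp
    from tendsto_real_sqrt[OF this] show ?thesis by (simp add: tendsto_rabs_zero_iff)
  qed
  have second_order: "(\<lambda>k. exp ((r k)\<^sup>2) *\<^sub>R (cis (- \<delta> k) * (1 + \<i> * complex_of_real (\<delta> k)) - 1)) \<longlonglongrightarrow> 0"
  proof (rule Lim_null_comparison[OF always_eventually b_lim], rule allI)
    fix k
    \<comment> \<open>The Taylor remainder at a real point, multiplied by a phase.\<close>
    have "cis (- \<delta> k) * (1 + \<i> * complex_of_real (\<delta> k)) - 1 = - (cis (- \<delta> k) * char_remainder 1 (complex_of_real (\<delta> k)))"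
      by (simp add: char_remainder_def cis_mult right_diff_distrib distrib_left)
    then have "norm (cis (- \<delta> k) * (1 + \<i> * complex_of_real (\<delta> k)) - 1) \<le> (\<delta> k)\<^sup>2 / 2"
      using char_remainder_bounds(2)[of 1 "complex_of_real (\<delta> k)"] by (simp add: norm_mult)
    then have "norm (exp ((r k)\<^sup>2) *\<^sub>R (cis (- \<delta> k) * (1 + \<i> * complex_of_real (\<delta> k)) - 1)) \<le> exp ((r k)\<^sup>2) * ((\<delta> k)\<^sup>2 / 2)"
      by simp
    also have "\<dots> \<le> exp ((r k)\<^sup>2) * (\<delta> k)\<^sup>2" by simp
    finally show "norm (exp ((r k)\<^sup>2) *\<^sub>R (cis (- \<delta> k) * (1 + \<i> * complex_of_real (\<delta> k)) - 1)) \<le> b k"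
      using \<delta>2[of k] by linarith
  qed
  have cis_lim: "(\<lambda>k. cis (- \<delta> k)) \<longlonglongrightarrow> 1"
  proof -
    have "(\<lambda>k. - \<delta> k) \<longlonglongrightarrow> 0" using tendsto_minus[OF \<delta>_lim] by simp
    from isCont_tendsto_compose[OF isCont_iexp this]
    show ?thesis by (simp add: cis_conv_exp)
  qed
  have "(\<lambda>k. exp ((r k)\<^sup>2) *\<^sub>R (cis (- \<delta> k) * (1 + \<i> * complex_of_real (\<delta> k)) - 1) + cis (- \<delta> k) * (exp ((r k)\<^sup>2) *\<^sub>R h k))
      \<longlonglongrightarrow> 0 + 1 * complex_of_real (- (cmod c)\<^sup>2 / 8)"
    unfolding h_def by (intro tendsto_add tendsto_mult second_order cis_lim remainder_integral_tendsto r)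
  then show ?thesis
    unfolding centred_char_expansion \<delta>_def[symmetric] h_def[symmetric]
    by (simp add: scaleR_conv_of_real algebra_simps)
qed

end

theorem theorem2p19:
  fixes M :: "'a measure"
    and X Y :: "nat \<Rightarrow> 'a \<Rightarrow> real"
    and \<rho> \<sigma> \<tau> :: real
  assumes "\<rho> \<in> {-1..1}"
    and "iid_gaussian_pairs M \<rho> X Y"
    and "\<sigma>\<^sup>2 = 1/2"
    and "\<tau> \<noteq> 0"
  shows "converges_in_distribution M
           (\<lambda>N \<omega>. (partition_function X Y (\<sigma>, \<tau>) N \<omega>
                    - nat_cpow N (1 + 1/2 * (1/2 - (complex_of_real \<tau>)\<^sup>2)
                                  + \<i> * complex_of_real (\<sigma> * \<tau> * \<rho>)))
                  / of_nat N)
           (complex_normal (1/2))"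
proof -
  interpret prob_space M using assms(2) by (simp add: iid_gaussian_pairs_def)
  interpret critical_line \<sigma> \<tau> \<rho> using assms by unfold_locales auto
  define r where "r N = sqrt (ln (real N))" for N :: nat
  define weight_at where "weight_at N p = exp (complex_of_real (r N) *
        (complex_of_real (\<sigma> * fst p) + \<i> * complex_of_real (\<tau> * snd p)))" for N and p :: "real \<times> real"
  define Z where "Z N \<omega> = (partition_function X Y (\<sigma>, \<tau>) N \<omega>
      - nat_cpow N (1 + 1/2 * (1/2 - (complex_of_real \<tau>)\<^sup>2) + \<i> * complex_of_real (\<sigma> * \<tau> * \<rho>))) / of_nat N" for N \<omega>
  define summand where "summand c N p = c \<bullet> ((weight_at N p - mean_weight (r N)) /\<^sub>R real N)" for c N p
  have pair_meas [measurable]: "X k \<in> borel_measurable M" "Y k \<in> borel_measurable M" if "1 \<le> k" for k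
    using assms(2) that by (auto simp: iid_gaussian_pairs_def bivariate_gaussian_def)
  have weight_at_meas [measurable]: "weight_at N \<in> borel_measurable (borel \<Otimes>\<^sub>M borel)" for N
    unfolding weight_at_def[abs_def] by measurable
  have summand_meas [measurable]: "summand c N \<in> borel_measurable (borel \<Otimes>\<^sub>M borel)" for c N
    unfolding summand_def[abs_def] by measurable
  have indep: "indep_vars (\<lambda>_. borel) (\<lambda>k \<omega>. (X k \<omega>, Y k \<omega>)) {1..}"
    using assms(2) by (simp add: iid_gaussian_pairs_def)
  have law: "distr M borel (\<lambda>\<omega>. Complex (X k \<omega>) (Y k \<omega>)) = gauss_plane \<rho>" if "1 \<le> k" for k
    using assms(2) that \<rho> prob_space_axioms
    by (intro bivariate_gaussian_law) (auto simp: iid_gaussian_pairs_def)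
  \<comment> \<open>For \<open>N = 0\<close> the default value \<open>ln 0 = 0\<close> would give \<open>exp ((r 0)\<^sup>2) = 1\<close>.\<close>
  have r2: "(r N)\<^sup>2 = ln (real N)" "exp ((r N)\<^sup>2) = real N" if "1 \<le> N" for N
    using that by (auto simp: r_def)
  have r_lim: "filterlim r at_top sequentially"
    unfolding r_def[abs_def]
    by (intro filterlim_compose[OF sqrt_at_top] filterlim_compose[OF ln_at_top] filterlim_real_sequentially)
  have cpow: "nat_cpow N (1 + 1/2 * (1/2 - (complex_of_real \<tau>)\<^sup>2) + \<i> * complex_of_real (\<sigma> * \<tau> * \<rho>))
      = of_nat N * mean_weight (r N)" if "1 \<le> N" for N
  proof -
    have exponent: "complex_of_real (ln (real N)) * (1 + 1/2 * (1/2 - (complex_of_real \<tau>)\<^sup>2) + \<i> * complex_of_real (\<sigma> * \<tau> * \<rho>))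
        = complex_of_real (ln (real N)) + complex_of_real ((r N)\<^sup>2 * ((1/2 - \<tau>\<^sup>2) / 2))
          + \<i> * complex_of_real ((r N)\<^sup>2 * (\<sigma> * \<tau> * \<rho>))"
      unfolding r2(1)[OF that] by (simp add: field_simps)
    show ?thesis
      using that unfolding nat_cpow_def mean_weight_def exponent exp_add exp_of_real
      by (simp add: cis_conv_exp scaleR_conv_of_real)
  qed
  have Z_sum: "c \<bullet> Z N \<omega> = (\<Sum>k=1..N. summand c N (X k \<omega>, Y k \<omega>))" if "1 \<le> N" for c N \<omega>
  proof -
    have "Z N \<omega> = (\<Sum>k=1..N. (weight_at N (X k \<omega>, Y k \<omega>) - mean_weight (r N)) /\<^sub>R real N)"
      unfolding Z_def cpow[OF that] partition_function_def weight_at_def r_def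
      by (simp add: sum_subtractf sum_distrib_left scaleR_conv_of_real divide_inverse scaleR_sum_right[symmetric] algebra_simps)
    then show ?thesis by (simp add: summand_def inner_sum_right)
  qed
  have Z_meas [measurable]: "Z N \<in> borel_measurable M" for N
    unfolding Z_def[abs_def] partition_function_def by measurable
  have summand_char: "char (distr M borel (\<lambda>\<omega>. summand c N (X k \<omega>, Y k \<omega>))) 1 = centred_char c (r N)"
    if "1 \<le> N" "1 \<le> k" for c N k
  proof -
    have [measurable]: "X k \<in> borel_measurable M" "Y k \<in> borel_measurable M" using pair_meas that by auto
    have "char (distr M borel (\<lambda>\<omega>. summand c N (X k \<omega>, Y k \<omega>))) 1
        = (\<integral>\<omega>. (\<lambda>z. cis (summand c N (Re z, Im z))) (Complex (X k \<omega>) (Y k \<omega>)) \<partial>M)"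
      unfolding char_def by (subst integral_distr) (auto simp: cis_conv_exp)
    also have "\<dots> = (\<integral>z. cis (summand c N (Re z, Im z)) \<partial>gauss_plane \<rho>)"
      unfolding law[OF that(2), symmetric] by (rule integral_distr[symmetric]) measurable
    also have "\<dots> = (\<integral>p. cis (summand c N (fst p, second p)) \<partial>gauss2)"
      unfolding gauss_plane_def second_def by (subst integral_distr) auto
    also have "\<dots> = centred_char c (r N)"
    proof -
      have "weight_at N (fst p, second p) = weight (r N) p" for p
        by (simp add: weight_at_def weight_def cis_conv_exp exp_of_real[symmetric] scaleR_conv_of_real exp_add[symmetric] algebra_simps)
      then show ?thesis unfolding centred_char_def summand_def r2(2)[OF that(1)] by simp
    qed
    finally show ?thesis .
  qed
  have Z_char: "planar_char (distr M borel (Z N)) c = centred_char c (r N) ^ N" if "1 \<le> N" for N c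
  proof -
    have "indep_vars (\<lambda>_. borel) (\<lambda>k \<omega>. summand c N (X k \<omega>, Y k \<omega>)) {1..N}"
      by (rule indep_vars_compose2[OF indep_vars_subset[OF indep]])
        (auto simp: borel_prod[symmetric])
    then have "char (distr M borel (\<lambda>\<omega>. \<Sum>k=1..N. summand c N (X k \<omega>, Y k \<omega>))) 1 = (\<Prod>k=1..N. centred_char c (r N))"
      using summand_char[OF that] by (simp add: char_distr_sum)
    moreover have "char (distr M borel (\<lambda>\<omega>. c \<bullet> Z N \<omega>)) 1 = planar_char (distr M borel (Z N)) c"
      unfolding char_def planar_char_distr[OF Z_meas] by (subst integral_distr) (auto simp: cis_conv_exp)
    ultimately show ?thesis by (simp add: Z_sum[OF that])
  qed
  have "(\<lambda>N. planar_char (distr M borel (Z N)) c) \<longlonglongrightarrow> planar_char (complex_normal (1/2)) c" for c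
  proof -
    have "eventually (\<lambda>N. exp ((r N)\<^sup>2) *\<^sub>R (centred_char c (r N) - 1) = real N *\<^sub>R (centred_char c (r N) - 1)) sequentially"
      using eventually_ge_at_top[of 1] by eventually_elim (simp add: r2)
    from Lim_transform_eventually[OF centred_char_asymptotics[OF r_lim] this]
    have "(\<lambda>N. centred_char c (r N) ^ N) \<longlonglongrightarrow> complex_of_real (exp (- ((cmod c)\<^sup>2 / 8)))"
      by (intro power_tendsto_exp norm_centred_char) auto
    moreover have "eventually (\<lambda>N. centred_char c (r N) ^ N = planar_char (distr M borel (Z N)) c) sequentially"
      using eventually_ge_at_top[of 1] by eventually_elim (simp add: Z_char)
    ultimately have "(\<lambda>N. planar_char (distr M borel (Z N)) c) \<longlonglongrightarrow> complex_of_real (exp (- ((cmod c)\<^sup>2 / 8)))"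
      by (rule Lim_transform_eventually)
    also have "complex_of_real (exp (- ((cmod c)\<^sup>2 / 8))) = planar_char (complex_normal (1/2)) c"
      using planar_char_complex_normal[of "1/2" c] by (simp add: power2_eq_square)
    finally show ?thesis .
  qed
  then have "(\<lambda>N. \<integral>z. f z \<partial>distr M borel (Z N)) \<longlonglongrightarrow> (\<integral>z. f z \<partial>complex_normal (1/2))"
    if "continuous_on UNIV f" "bounded (range f)" for f :: "complex \<Rightarrow> real"
    using that prob_space_complex_normal[of "1/2"]
    by (intro planar_levy_continuity prob_space_distr) (auto simp: power2_eq_square complex_normal_def)
  then show ?thesis
    unfolding converges_in_distribution_def Z_def by blast
qed

end
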